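(* Let $\alpha,\beta\in(1,2)$, $K_\alpha,K_\beta>0$, $L_a,L_b,T>0$, $\Omega=(0,L_a)\times(0,L_b)$. Let $u(x,y,t)$ be the solution of $$\frac{\partial u(x,y,t)}{\partial t}=-u(x,y,t)+K_\alpha\frac{\partial^\alpha u(x,y,t)}{\partial|x|^\alpha}+K_\beta\frac{\partial^\beta u(x,y,t)}{\partial|y|^\beta}+f(x,y,t),\quad (x,y;t)\in\Omega\times(0,T],$$ $$u(x,y,0)=u^0(x,y),\ (x,y)\in\overline\Omega,\qquad u(x,y,t)=0,\ (x,y;t)\in\partial\Omega\times(0,T],$$ and let $u_{i,j}^k$ be the solution of the finite difference scheme $$\mathcal{L}_x\mathcal{L}_y\delta_tu_{i,j}^{k+\frac12}=-\mathcal{L}_x\mathcal{L}_yu_{i,j}^{k+\frac12}+K_\alpha\mathcal{L}_y\delta_x^\alpha u_{i,j}^{k+\frac12}+K_\beta\mathcal{L}_x\delta_y^\beta u_{i,j}^{k+\frac12}+\mathcal{L}_x\mathcal{L}_yf_{i,j}^{k+\frac12},$$ $1\le i\le M_a-1$, $1\le j\le M_b-1$, $0\le k\le N-1$, with $u_{i,j}^0=u^0(x_i,y_j)$ for $(x_i,y_j)\in\overline\Omega_h$ and $u_{i,j}^k=0$ for $(x_i,y_j)\in\partial\Omega_h$, $1\le k\le N$. Denote $e_{i,j}^k=u_{i,j}^k-u(x_i,y_j,t_k)$, $0\le k\le N$, $0\le i\le M_a$, $0\le j\le M_b$. Then $$\|\boldsymbol e^k\|\le 32\,C_2\sqrt{TL_aL_b}\,\exp(8T)\,(\tau^2+h_a^3+h_b^3),\qquad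 0\le k\le N,$$ where $C_2$ is a positive constant (independent of $\tau,h_a,h_b$).
   Context: Grid: $\tau=T/N$, $h_a=L_a/M_a$, $h_b=L_b/M_b$ ($M_a,M_b,N$ positive integers), $t_k=k\tau$, $t_{k+\frac12}=(k+\frac12)\tau$, $x_i=ih_a$, $y_j=jh_b$; $\overline\Omega_h=\{(x_i,y_j):0\le i\le M_a,0\le j\le M_b\}$, $\partial\Omega_h=\overline\Omega_h\cap\partial\Omega$. Notation: $\delta_tu_{i,j}^{k+\frac12}=\frac{u_{i,j}^{k+1}-u_{i,j}^k}{\tau}$, $u_{i,j}^{k+\frac12}=\frac{u_{i,j}^{k+1}+u_{i,j}^k}{2}$, $f_{i,j}^{k+\frac12}=f(x_i,y_j,t_{k+\frac12})$. Riesz derivative of order $\gamma\in(1,2)$ on $(a,b)$: $\frac{\partial^\gamma u}{\partial|x|^\gamma}=-\frac{1}{2\cos(\pi\gamma/2)}\left({}_{RL}D_{a,x}^\gamma+{}_{RL}D_{x,b}^\gamma\right)u$ with ${}_{RL}D_{a,x}^{\gamma}u(x)=\frac{1}{\Gamma(2-\gamma)}\frac{d^2}{dx^2}\int_{a}^{x}\frac{u(s)ds}{(x-s)^{\gamma-1}}$ and ${}_{RL}D_{x,b}^{\gamma}u(x)=\frac{1}{\Gamma(2-\gamma)}\frac{d^2}{dx^2}\int_{x}^{b}\frac{u(s)ds}{(s-x)^{\gamma-1}}$; it is applied in $x$ on $(0,L_a)$ with $\gamma=\alpha$ and in $y$ on $(0,L_b)$ with $\gamma=\beta$. For $\gamma\in(1,2)$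 put $\sigma_2^{(\gamma)}=-\frac{2\gamma^2-6\gamma+3}{6\gamma}$ and define $\kappa_{2,\ell}^{(\gamma)}$ by $\left(\frac{3\gamma-2}{2\gamma}-\frac{2(\gamma-1)}{\gamma}z+\frac{\gamma-2}{2\gamma}z^2\right)^{\gamma}=\sum_{\ell=0}^{\infty}\kappa_{2,\ell}^{(\gamma)}z^\ell$, $|z|<1$. Then $$\mathcal{L}_xw_{i,j}=w_{i,j}+\sigma_2^{(\alpha)}(w_{i+1,j}-2w_{i,j}+w_{i-1,j}),\qquad \mathcal{L}_yw_{i,j}=w_{i,j}+\sigma_2^{(\beta)}(w_{i,j+1}-2w_{i,j}+w_{i,j-1}),$$ $$\delta_x^\alpha w_{i,j}=-\frac{1}{2\cos(\frac{\pi\alpha}{2})h_a^\alpha}\left(\sum_{\ell=0}^{i+1}\kappa_{2,\ell}^{(\alpha)}w_{i-\ell+1,j}+\sum_{\ell=0}^{M_a-i+1}\kappa_{2,\ell}^{(\alpha)}w_{i+\ell-1,j}\right),$$ $$\delta_y^\beta w_{i,j}=-\frac{1}{2\cos(\frac{\pi\beta}{2})h_b^\beta}\left(\sum_{\ell=0}^{j+1}\kappa_{2,\ell}^{(\beta)}w_{i,j-\ell+1}+\sum_{\ell=0}^{M_b-j+1}\kappa_{2,\ell}^{(\beta)}w_{i,j+\ell-1}\right).$$ Norm: $\|\boldsymbol v\|^2=h_ah_b\sum_{i=1}^{M_a-1}\sum_{j=1}^{M_b-1}v_{i,j}^2$ for grid functions vanishing on $\partial\Omega_h$. Standing assumption: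 $f$, $u^0$ and the solution $u$ are smooth enough that the local truncation error obeys the expected bound: with $U_{i,j}^k=u(x_i,y_j,t_k)$ and $$R_{i,j}^k=\mathcal{L}_x\mathcal{L}_y\delta_tU_{i,j}^{k+\frac12}+\mathcal{L}_x\mathcal{L}_yU_{i,j}^{k+\frac12}-K_\alpha\mathcal{L}_y\delta_x^\alpha U_{i,j}^{k+\frac12}-K_\beta\mathcal{L}_x\delta_y^\beta U_{i,j}^{k+\frac12}-\mathcal{L}_x\mathcal{L}_yf(x_i,y_j,t_{k+\frac12}),$$ there is a positive constant $C$ independent of $\tau,h_a,h_b$ with $|R_{i,j}^k|\le C(\tau^2+h_a^3+h_b^3)$ for all $1\le i\le M_a-1$, $1\le j\le M_b-1$, $0\le k\le N-1$. *)

theory Defs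
  imports "HOL-Complex_Analysis.Complex_Analysis"
begin

section \<open>Riemann--Liouville and Riesz derivatives of order \<open>\<gamma> \<in> (1,2)\<close>\<close>

definition rl_kernel_left :: "real \<Rightarrow> (real \<Rightarrow> real) \<Rightarrow> real \<Rightarrow> real \<Rightarrow> real" where
  "rl_kernel_left \<gamma> v x s = v s / (x - s) powr (\<gamma> - 1)"

definition rl_kernel_right :: "real \<Rightarrow> (real \<Rightarrow> real) \<Rightarrow> real \<Rightarrow> real \<Rightarrow> real" where
  "rl_kernel_right \<gamma> v x s = v s / (s - x) powr (\<gamma> - 1)"

definition rl_integral_left :: "real \<Rightarrow> real \<Rightarrow> (real \<Rightarrow> real) \<Rightarrow> real \<Rightarrow> real" where
  "rl_integral_left \<gamma> a v x = integral {a..x} (rl_kernel_left \<gamma> v x)"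

definition rl_integral_right :: "real \<Rightarrow> real \<Rightarrow> (real \<Rightarrow> real) \<Rightarrow> real \<Rightarrow> real" where
  "rl_integral_right \<gamma> b v x = integral {x..b} (rl_kernel_right \<gamma> v x)"

definition rl_deriv_left :: "real \<Rightarrow> real \<Rightarrow> (real \<Rightarrow> real) \<Rightarrow> real \<Rightarrow> real" where
  "rl_deriv_left \<gamma> a v x = 1 / Gamma (2 - \<gamma>) * (deriv ^^ 2) (rl_integral_left \<gamma> a v) x"

definition rl_deriv_right :: "real \<Rightarrow> real \<Rightarrow> (real \<Rightarrow> real) \<Rightarrow> real \<Rightarrow> real" where
  "rl_deriv_right \<gamma> b v x = 1 / Gamma (2 - \<gamma>) * (deriv ^^ 2) (rl_integral_right \<gamma> b v) x"

definition riesz_deriv :: "real \<Rightarrow> real \<Rightarrow> real \<Rightarrow> (real \<Rightarrow> real) \<Rightarrow> real \<Rightarrow> real" where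
  "riesz_deriv \<gamma> a b v x =
     - 1 / (2 * cos (pi * \<gamma> / 2)) * (rl_deriv_left \<gamma> a v x + rl_deriv_right \<gamma> b v x)"

text \<open>
  The constants \<^const>\<open>integral\<close> and \<^const>\<open>deriv\<close> are total, so an equation involving
  \<^const>\<open>riesz_deriv\<close> is meaningful only where the integrals and the two derivatives exist.
\<close>

definition twice_differentiable_on :: "(real \<Rightarrow> real) \<Rightarrow> real set \<Rightarrow> bool" where
  "twice_differentiable_on g S \<longleftrightarrow>
     (\<forall>x\<in>S. g differentiable (at x) \<and> deriv g differentiable (at x))"

definition riesz_differentiable :: "real \<Rightarrow> real \<Rightarrow> real \<Rightarrow> (real \<Rightarrow> real) \<Rightarrow> bool" where
  "riesz_differentiable \<gamma> a b v \<longleftrightarrow>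
     (\<forall>x\<in>{a<..<b}. rl_kernel_left \<gamma> v x absolutely_integrable_on {a..x} \<and>
                    rl_kernel_right \<gamma> v x absolutely_integrable_on {x..b}) \<and>
     twice_differentiable_on (rl_integral_left \<gamma> a v) {a<..<b} \<and>
     twice_differentiable_on (rl_integral_right \<gamma> b v) {a<..<b}"


section \<open>The initial-boundary value problem\<close>

definition Omega :: "real \<Rightarrow> real \<Rightarrow> (real \<times> real) set" where
  "Omega La Lb = {0<..<La} \<times> {0<..<Lb}"

text \<open>
  At \<open>t = T\<close> the time derivative is one-sided; for \<open>0 < t < T\<close> the filter
  \<open>at t within {0..T}\<close> agrees with \<open>at t\<close>.
\<close>

definition is_pde_solution ::
  "real \<Rightarrow> real \<Rightarrow> real \<Rightarrow> real \<Rightarrow> real \<Rightarrow> real \<Rightarrow> real \<Rightarrow>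
   (real \<Rightarrow> real \<Rightarrow> real \<Rightarrow> real) \<Rightarrow> (real \<Rightarrow> real \<Rightarrow> real) \<Rightarrow> (real \<Rightarrow> real \<Rightarrow> real \<Rightarrow> real) \<Rightarrow> bool" where
  "is_pde_solution \<alpha> \<beta> K\<^sub>\<alpha> K\<^sub>\<beta> La Lb T f u0 u \<longleftrightarrow>
     (\<forall>y\<in>{0<..<Lb}. \<forall>t\<in>{0<..T}. riesz_differentiable \<alpha> 0 La (\<lambda>x. u x y t)) \<and>
     (\<forall>x\<in>{0<..<La}. \<forall>t\<in>{0<..T}. riesz_differentiable \<beta> 0 Lb (\<lambda>y. u x y t)) \<and>
     (\<forall>(x, y)\<in>Omega La Lb. \<forall>t\<in>{0<..T}.
        ((\<lambda>s. u x y s) has_real_derivative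
           (- u x y t + K\<^sub>\<alpha> * riesz_deriv \<alpha> 0 La (\<lambda>\<xi>. u \<xi> y t) x
                      + K\<^sub>\<beta> * riesz_deriv \<beta> 0 Lb (\<lambda>\<eta>. u x \<eta> t) y + f x y t))
          (at t within {0..T})) \<and>
     (\<forall>(x, y)\<in>closure (Omega La Lb). u x y 0 = u0 x y) \<and>
     (\<forall>(x, y)\<in>frontier (Omega La Lb). \<forall>t\<in>{0<..T}. u x y t = 0)"


section \<open>The coefficients of the difference operators\<close>

definition \<sigma>\<^sub>2 :: "real \<Rightarrow> real" where
  "\<sigma>\<^sub>2 \<gamma> = - (2 * \<gamma>\<^sup>2 - 6 * \<gamma> + 3) / (6 * \<gamma>)"

definition gen_base :: "real \<Rightarrow> complex \<Rightarrow> complex" where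
  "gen_base \<gamma> z = of_real ((3 * \<gamma> - 2) / (2 * \<gamma>)) - of_real (2 * (\<gamma> - 1) / \<gamma>) * z
                  + of_real ((\<gamma> - 2) / (2 * \<gamma>)) * z\<^sup>2"

text \<open>
  For \<open>1 < \<gamma> < 2\<close> the base avoids the closed negative real axis on the open unit disc, so the
  principal power is holomorphic there; existence and uniqueness of the coefficients are
  established by \<open>kappa_ex1\<close> below.
\<close>

definition \<kappa>\<^sub>2 :: "real \<Rightarrow> nat \<Rightarrow> real" where
  "\<kappa>\<^sub>2 \<gamma> = (THE c. \<forall>z::complex. norm z < 1 \<longrightarrow>
                  (\<lambda>l. of_real (c l) * z ^ l) sums (gen_base \<gamma> z powr of_real \<gamma>))"

lemma power_series_unit_disc_unique:
  fixes a b :: "nat \<Rightarrow> complex"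
  assumes a: "\<And>z. norm z < 1 \<Longrightarrow> (\<lambda>n. a n * z ^ n) sums g z"
    and b: "\<And>z. norm z < 1 \<Longrightarrow> (\<lambda>n. b n * z ^ n) sums g z"
  shows "a = b"
proof (rule ccontr)
  assume "a \<noteq> b"
  then obtain m where m: "a m - b m \<noteq> 0" by auto
  have s: "(\<lambda>n. (a n - b n) * z ^ n) sums 0" if "norm (z::complex) < 1" for z
    using sums_diff[OF a[OF that] b[OF that]] by (simp add: algebra_simps)
  have "a 0 - b 0 = 0"
    using s[of 0] powser_sums_zero[of "\<lambda>n. a n - b n"] by (auto intro: sums_unique2)
  with m have "m > 0" by (metis not_gr_zero)
  obtain e :: real where e: "0 < e" "\<And>z. z \<in> cball (0::complex) e - {0} \<Longrightarrow> (0::complex) \<noteq> 0"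
    by (rule powser_0_nonzero[of 1 "0::complex" "\<lambda>n. a n - b n" "\<lambda>_. 0" m])
       (use s m \<open>m > 0\<close> in auto)
  have "of_real e \<in> cball (0::complex) e - {0}" using e(1) by simp
  then show False using e(2) by blast
qed

lemma gen_base_factor:
  assumes "1 < \<gamma>" "\<gamma> < 2"
  shows "gen_base \<gamma> z = (1 - z) * (of_real ((3*\<gamma> - 2)/(2*\<gamma>)) - of_real ((\<gamma> - 2)/(2*\<gamma>)) * z)"
proof -
  have "2 * (\<gamma> - 1) / \<gamma> = (3*\<gamma> - 2)/(2*\<gamma>) + (\<gamma> - 2)/(2*\<gamma>)"
    using assms by (simp add: field_simps)
  then show ?thesis
    unfolding gen_base_def by (simp only: of_real_add) (simp add: algebra_simps power2_eq_square del: of_real_divide of_real_diff of_real_mult)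
qed

lemma gen_base_not_nonpos:
  assumes \<gamma>: "1 < \<gamma>" "\<gamma> < 2" and z: "norm z < 1"
  shows "gen_base \<gamma> z \<notin> \<real>\<^sub>\<le>\<^sub>0"
proof
  define p where "p = 1 - z"
  define q where "q = of_real ((3*\<gamma> - 2)/(2*\<gamma>)) - of_real ((\<gamma> - 2)/(2*\<gamma>)) * z"
  have Rz: "\<bar>Re z\<bar> < 1" using z abs_Re_le_cmod[of z] by linarith
  have p: "Re p > 0" using Rz by (simp add: p_def)
  have "(2 - \<gamma>)/(2*\<gamma>) * Re z \<ge> (2 - \<gamma>)/(2*\<gamma>) * (-1)"
    using Rz \<gamma> by (intro mult_left_mono) auto
  moreover have "(3*\<gamma> - 2)/(2*\<gamma>) - (2 - \<gamma>)/(2*\<gamma>) > 0"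
    using \<gamma> by (simp add: field_simps)
  moreover have "Re q = (3*\<gamma> - 2)/(2*\<gamma>) + (2 - \<gamma>)/(2*\<gamma>) * Re z"
    unfolding q_def using \<gamma> by (simp add: field_simps Re_divide_numeral)
  ultimately have q: "Re q > 0" by linarith
  assume "gen_base \<gamma> z \<in> \<real>\<^sub>\<le>\<^sub>0"
  then have *: "p * q \<in> \<real>\<^sub>\<le>\<^sub>0" using gen_base_factor[OF \<gamma>, of z] p_def q_def by simp
  then have im: "Im p * Re q = - (Re p * Im q)" and re: "Re p * Re q \<le> Im p * Im q"
    by (auto simp: complex_nonpos_Reals_iff algebra_simps)
  have "Re p * Re q * Re q \<le> Im p * Im q * Re q"
    using re q by (intro mult_right_mono) auto
  also have "\<dots> = - (Re p * (Im q)\<^sup>2)"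
    using im by (metis (no_types, opaque_lifting) mult.assoc mult.commute mult_minus_left power2_eq_square)
  also have "\<dots> \<le> 0" using p by simp
  finally show False using p q by (simp add: mult_le_0_iff)
qed

lemma kappa_ex1:
  assumes \<gamma>: "1 < \<gamma>" "\<gamma> < 2"
  shows "\<exists>!c::nat \<Rightarrow> real. \<forall>z::complex. norm z < 1 \<longrightarrow>
           (\<lambda>l. of_real (c l) * z ^ l) sums (gen_base \<gamma> z powr of_real \<gamma>)"
proof -
  define g where "g = (\<lambda>z. gen_base \<gamma> z powr of_real \<gamma>)"
  have hol: "g holomorphic_on ball 0 1"
  proof -
    have "gen_base \<gamma> holomorphic_on ball 0 1"
      unfolding gen_base_def by (intro holomorphic_intros)
    then show ?thesis
      unfolding g_def
      by (intro holomorphic_on_powr holomorphic_intros) (auto dest: gen_base_not_nonpos[OF \<gamma>])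
  qed
  define a where "a = (\<lambda>n. (deriv ^^ n) g 0 / fact n)"
  have a: "(\<lambda>n. a n * z ^ n) sums g z" if "norm z < 1" for z
    using holomorphic_power_series[OF hol, of z] that by (simp add: a_def)
  have g_cnj: "cnj (g (cnj z)) = g z" if "norm z < 1" for z
  proof -
    have "cnj (gen_base \<gamma> (cnj z)) = gen_base \<gamma> z" by (simp add: gen_base_def)
    moreover have "gen_base \<gamma> (cnj z) \<notin> \<real>\<^sub>\<le>\<^sub>0" using gen_base_not_nonpos[OF \<gamma>] that by simp
    ultimately show ?thesis
      unfolding g_def by (subst cnj_powr) (auto simp: complex_nonpos_Reals_iff)
  qed
  have "(\<lambda>n. cnj (a n) * z ^ n) sums g z" if "norm z < 1" for z
  proof -
    have "(\<lambda>n. cnj (a n * (cnj z) ^ n)) sums cnj (g (cnj z))"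
      using a[of "cnj z"] that by (simp only: sums_cnj complex_mod_cnj)
    then show ?thesis using g_cnj[OF that] by simp
  qed
  with a have "a = (\<lambda>n. cnj (a n))" by (intro power_series_unit_disc_unique[of a g])
  then have "of_real (Re (a n)) = a n" for n
    by (metis Reals_cnj_iff of_real_Re)
  then have ex: "\<forall>z::complex. norm z < 1 \<longrightarrow> (\<lambda>l. of_real (Re (a l)) * z ^ l) sums g z"
    using a by simp
  show ?thesis
  proof (rule ex1I[of _ "\<lambda>l. Re (a l)"])
    show "\<forall>z::complex. norm z < 1 \<longrightarrow>
      (\<lambda>l. of_real (Re (a l)) * z ^ l) sums (gen_base \<gamma> z powr of_real \<gamma>)"
      using ex by (simp add: g_def)
    fix c :: "nat \<Rightarrow> real"
    assume "\<forall>z::complex. norm z < 1 \<longrightarrow>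
      (\<lambda>l. of_real (c l) * z ^ l) sums (gen_base \<gamma> z powr of_real \<gamma>)"
    then have "(\<lambda>l. complex_of_real (c l)) = a"
      using a by (intro power_series_unit_disc_unique[of _ g]) (auto simp: g_def)
    then show "c = (\<lambda>l. Re (a l))" by auto
  qed
qed

lemma kappa_sums:
  assumes "1 < \<gamma>" "\<gamma> < 2" "norm (z::complex) < 1"
  shows "(\<lambda>l. of_real (\<kappa>\<^sub>2 \<gamma> l) * z ^ l) sums (gen_base \<gamma> z powr of_real \<gamma>)"
  using theI'[OF kappa_ex1[OF assms(1,2)]] assms(3) unfolding \<kappa>\<^sub>2_def by blast


section \<open>Difference operators on grid functions\<close>

text \<open>
  A grid function is a map of the two natural-number indices \<open>i\<close>, \<open>j\<close>. The operators in \<open>x\<close>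
  are meant for \<open>i \<ge> 1\<close> and those in \<open>y\<close> for \<open>j \<ge> 1\<close>, so that the subtractions on indices do not
  truncate. The arguments \<open>h\<close> and \<open>M\<close> are the mesh width and the number of cells in the
  direction concerned.
\<close>

type_synonym grid_fun = "nat \<Rightarrow> nat \<Rightarrow> real"

definition Lx :: "real \<Rightarrow> grid_fun \<Rightarrow> grid_fun" where
  "Lx \<alpha> w i j = w i j + \<sigma>\<^sub>2 \<alpha> * (w (i + 1) j - 2 * w i j + w (i - 1) j)"

definition Ly :: "real \<Rightarrow> grid_fun \<Rightarrow> grid_fun" where
  "Ly \<beta> w i j = w i j + \<sigma>\<^sub>2 \<beta> * (w i (j + 1) - 2 * w i j + w i (j - 1))"

definition \<delta>x :: "real \<Rightarrow> real \<Rightarrow> nat \<Rightarrow> grid_fun \<Rightarrow> grid_fun" where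
  "\<delta>x \<alpha> h M w i j = - 1 / (2 * cos (pi * \<alpha> / 2) * h powr \<alpha>) *
     ((\<Sum>l = 0..i + 1. \<kappa>\<^sub>2 \<alpha> l * w (i + 1 - l) j) +
      (\<Sum>l = 0..M - i + 1. \<kappa>\<^sub>2 \<alpha> l * w (i + l - 1) j))"

definition \<delta>y :: "real \<Rightarrow> real \<Rightarrow> nat \<Rightarrow> grid_fun \<Rightarrow> grid_fun" where
  "\<delta>y \<beta> h M w i j = - 1 / (2 * cos (pi * \<beta> / 2) * h powr \<beta>) *
     ((\<Sum>l = 0..j + 1. \<kappa>\<^sub>2 \<beta> l * w i (j + 1 - l)) +
      (\<Sum>l = 0..M - j + 1. \<kappa>\<^sub>2 \<beta> l * w i (j + l - 1)))"

text \<open>Time levels come first: \<open>v k i j\<close> stands for the value at \<open>(x\<^sub>i, y\<^sub>j, t\<^sub>k)\<close>.\<close>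

definition \<delta>t :: "real \<Rightarrow> (nat \<Rightarrow> grid_fun) \<Rightarrow> nat \<Rightarrow> grid_fun" where
  "\<delta>t \<tau> v k i j = (v (k + 1) i j - v k i j) / \<tau>"

definition midlevel :: "(nat \<Rightarrow> grid_fun) \<Rightarrow> nat \<Rightarrow> grid_fun" where
  "midlevel v k i j = (v (k + 1) i j + v k i j) / 2"

definition grid_norm :: "real \<Rightarrow> real \<Rightarrow> nat \<Rightarrow> nat \<Rightarrow> grid_fun \<Rightarrow> real" where
  "grid_norm ha hb Ma Mb v = sqrt (ha * hb * (\<Sum>i = 1..Ma - 1. \<Sum>j = 1..Mb - 1. (v i j)\<^sup>2))"


section \<open>The scheme and its local truncation error\<close>

definition step :: "real \<Rightarrow> nat \<Rightarrow> real" where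
  "step L M = L / real M"

definition sample ::
  "real \<Rightarrow> real \<Rightarrow> real \<Rightarrow> nat \<Rightarrow> nat \<Rightarrow> nat \<Rightarrow> (real \<Rightarrow> real \<Rightarrow> real \<Rightarrow> real) \<Rightarrow> nat \<Rightarrow> grid_fun" where
  "sample La Lb T Ma Mb N u k i j =
     u (real i * step La Ma) (real j * step Lb Mb) (real k * step T N)"

definition sample_mid ::
  "real \<Rightarrow> real \<Rightarrow> real \<Rightarrow> nat \<Rightarrow> nat \<Rightarrow> nat \<Rightarrow> (real \<Rightarrow> real \<Rightarrow> real \<Rightarrow> real) \<Rightarrow> nat \<Rightarrow> grid_fun" where
  "sample_mid La Lb T Ma Mb N f k i j =
     f (real i * step La Ma) (real j * step Lb Mb) ((real k + 1 / 2) * step T N)"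

definition is_scheme_solution ::
  "real \<Rightarrow> real \<Rightarrow> real \<Rightarrow> real \<Rightarrow> real \<Rightarrow> real \<Rightarrow> real \<Rightarrow>
   (real \<Rightarrow> real \<Rightarrow> real \<Rightarrow> real) \<Rightarrow> (real \<Rightarrow> real \<Rightarrow> real) \<Rightarrow>
   nat \<Rightarrow> nat \<Rightarrow> nat \<Rightarrow> (nat \<Rightarrow> grid_fun) \<Rightarrow> bool" where
  "is_scheme_solution \<alpha> \<beta> K\<^sub>\<alpha> K\<^sub>\<beta> La Lb T f u0 Ma Mb N v \<longleftrightarrow>
     (\<forall>i\<in>{1..Ma - 1}. \<forall>j\<in>{1..Mb - 1}. \<forall>k\<in>{0..N - 1}.
        Lx \<alpha> (Ly \<beta> (\<delta>t (step T N) v k)) i j =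
          - Lx \<alpha> (Ly \<beta> (midlevel v k)) i j
          + K\<^sub>\<alpha> * Ly \<beta> (\<delta>x \<alpha> (step La Ma) Ma (midlevel v k)) i j
          + K\<^sub>\<beta> * Lx \<alpha> (\<delta>y \<beta> (step Lb Mb) Mb (midlevel v k)) i j
          + Lx \<alpha> (Ly \<beta> (sample_mid La Lb T Ma Mb N f k)) i j) \<and>
     (\<forall>i\<in>{0..Ma}. \<forall>j\<in>{0..Mb}. v 0 i j = u0 (real i * step La Ma) (real j * step Lb Mb)) \<and>
     (\<forall>i\<in>{0..Ma}. \<forall>j\<in>{0..Mb}. \<forall>k\<in>{1..N}.
        (real i * step La Ma, real j * step Lb Mb) \<in> frontier (Omega La Lb) \<longrightarrow> v k i j = 0)"

definition truncation_error ::
  "real \<Rightarrow> real \<Rightarrow> real \<Rightarrow> real \<Rightarrow> real \<Rightarrow> real \<Rightarrow> real \<Rightarrow>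
   (real \<Rightarrow> real \<Rightarrow> real \<Rightarrow> real) \<Rightarrow> (real \<Rightarrow> real \<Rightarrow> real \<Rightarrow> real) \<Rightarrow>
   nat \<Rightarrow> nat \<Rightarrow> nat \<Rightarrow> nat \<Rightarrow> grid_fun" where
  "truncation_error \<alpha> \<beta> K\<^sub>\<alpha> K\<^sub>\<beta> La Lb T f u Ma Mb N k i j =
     (let U = sample La Lb T Ma Mb N u in
        Lx \<alpha> (Ly \<beta> (\<delta>t (step T N) U k)) i j
        + Lx \<alpha> (Ly \<beta> (midlevel U k)) i j
        - K\<^sub>\<alpha> * Ly \<beta> (\<delta>x \<alpha> (step La Ma) Ma (midlevel U k)) i j
        - K\<^sub>\<beta> * Lx \<alpha> (\<delta>y \<beta> (step Lb Mb) Mb (midlevel U k)) i j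
        - Lx \<alpha> (Ly \<beta> (sample_mid La Lb T Ma Mb N f k)) i j)"

end

theory Submission
  imports Defs
begin

text \<open>
  The estimate is an energy argument. The error \<open>e\<close> of the scheme vanishes at time \<open>0\<close> and on the
  boundary of the grid, and it satisfies the scheme with the source replaced by minus the local
  truncation error \<open>R\<close>. Pair the error equation with the mean \<open>w\<close> of two consecutive time levels.
  
  The operator \<open>Lx\<close> has symbol \<open>1 - \<sigma>\<^sub>2 (2 - 2 cos \<theta>)\<close> with \<open>0 < \<sigma>\<^sub>2 < 1/4\<close>. The symbol is the squared
  modulus of \<open>p + q e\<^bsup>i\<theta>\<^esup>\<close> for suitable real \<open>p\<close> and \<open>q\<close>, so that \<open>Lx\<close> is \<open>G\<^sup>T G\<close> for a bidiagonal
  \<open>G\<close> (\<open>sum_tridiag_eq_bidiag\<close>), and it is at least \<open>1 - 4 \<sigma>\<^sub>2\<close> (\<open>sum_bidiag_square_ge\<close>). Therefore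
  \<open>E\<^sub>k = \<parallel>Gx Gy e\<^sup>k\<parallel>\<^sup>2\<close> is a discrete energy: pairing \<open>w\<close> with the time difference of \<open>e\<close> gives
  \<open>(E\<^bsub>k+1\<^esub> - E\<^sub>k) / (2 \<tau>)\<close>, and \<open>E\<^sub>k \<ge> c \<parallel>e\<^sup>k\<parallel>\<^sup>2\<close> with a constant \<open>c > 0\<close> that depends only on \<open>\<alpha>\<close>
  and \<open>\<beta>\<close>.
  
  The fractional terms have the right sign. As \<open>G\<close> in one direction commutes with the fractional
  quotient in the other, this is the one-dimensional statement that the Toeplitz form with
  coefficients \<open>\<kappa>\<^sub>2 \<gamma> (i - m + 1)\<close> is nonpositive (\<open>kappa_form_nonpos\<close>), which follows once the real
  part of its symbol \<open>e\<^bsup>-i\<theta>\<^esup> g(e\<^bsup>i\<theta>\<^esup>)\<close>, where \<open>g(z) = gen_base \<gamma> z powr \<gamma>\<close>, is nonpositive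
  (\<open>Re_symbol_nonpos\<close>). With \<open>s = (2 - \<gamma>) / (2 \<gamma>)\<close> the base factors as \<open>(1 - z) (1 - s + s z)\<close>. For
  \<open>0 < \<theta> \<le> \<pi>\<close> the first factor has argument \<open>(\<theta> - \<pi>) / 2\<close> and the second one an argument between \<open>0\<close>
  and \<open>s \<theta>\<close>; hence the argument of the symbol lies between \<open>-\<pi>\<close> and \<open>-\<gamma> \<pi> / 2\<close>.
  
  The damping term \<open>-Lx Ly w\<close> absorbs the pairing of \<open>w\<close> with \<open>R\<close>, and
  \<open>E\<^bsub>k+1\<^esub> \<le> E\<^sub>k + \<tau> / (2 c) \<parallel>R\<^sup>k\<parallel>\<^sup>2\<close> (\<open>energy_step\<close>). Summation over the time levels gives a bound
  without an exponential factor, which is stronger than required.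
\<close>


section \<open>The symbol of the fractional difference quotient\<close>

lemma sin_scaled_le:
  fixes s \<theta> :: real
  assumes "0 \<le> s" "s \<le> 1 / 2" "0 \<le> \<theta>" "\<theta> \<le> pi"
  shows "s * sin ((1 - s) * \<theta>) \<le> (1 - s) * sin (s * \<theta>)"
proof -
  define F where "F = (\<lambda>t. (1 - s) * sin (s * t) - s * sin ((1 - s) * t))"
  have "F 0 \<le> F \<theta>"
  proof (rule DERIV_nonneg_imp_nondecreasing[OF assms(3)])
    fix t assume t: "0 \<le> t" "t \<le> \<theta>"
    have "s * t \<le> (1 - s) * t"
      using assms t by (intro mult_right_mono) auto
    moreover have "(1 - s) * t \<le> 1 * pi"
      using assms t by (intro mult_mono) auto
    ultimately have "cos ((1 - s) * t) \<le> cos (s * t)"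
      using assms t by (intro cos_monotone_0_pi_le) auto
    then have "0 \<le> s * (1 - s) * (cos (s * t) - cos ((1 - s) * t))"
      using assms by simp
    moreover have "(F has_real_derivative
        s * (1 - s) * (cos (s * t) - cos ((1 - s) * t))) (at t)"
      unfolding F_def by (auto intro!: derivative_eq_intros simp: algebra_simps)
    ultimately show "\<exists>y. (F has_real_derivative y) (at t) \<and> 0 \<le> y" by blast
  qed
  then show ?thesis by (simp add: F_def)
qed

lemma gen_base_factor_affine:
  assumes "1 < \<gamma>"
  defines "s \<equiv> (2 - \<gamma>) / (2 * \<gamma>)"
  shows "gen_base \<gamma> z = (1 - z) * (of_real (1 - s) + of_real s * z)"
proof -
  have c: "(3 * \<gamma> - 2) / (2 * \<gamma>) = 1 - s" "2 * (\<gamma> - 1) / \<gamma> = 1 - 2 * s"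
    "(\<gamma> - 2) / (2 * \<gamma>) = - s"
    using assms(1) by (auto simp: s_def field_simps)
  show ?thesis
    unfolding gen_base_def c by (simp add: algebra_simps power2_eq_square)
qed

lemma one_minus_cis:
  "1 - cis \<theta> = of_real (2 * sin (\<theta> / 2)) * cis ((\<theta> - pi) / 2)"
proof -
  have t: "\<theta> = 2 * (\<theta> / 2)" by simp
  have e: "(\<theta> - pi) / 2 = \<theta> / 2 - pi / 2" by (simp add: field_simps)
  have r: "1 - cos \<theta> = 2 * sin (\<theta> / 2) * sin (\<theta> / 2)"
    by (subst t, subst cos_double_sin) (simp add: power2_eq_square)
  have i: "sin \<theta> = 2 * sin (\<theta> / 2) * cos (\<theta> / 2)"
    by (subst t, subst sin_double) simp
  show ?thesis
    unfolding e by (rule complex_eqI) (simp_all add: r i cos_diff sin_diff)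
qed

text \<open>
  The branch of the power matters here: the argument \<open>\<psi>\<close> of the base lies in \<open>(-\<pi>, \<pi>]\<close>, so that the
  principal power multiplies exactly this value by \<open>\<gamma>\<close>.
\<close>

lemma Re_symbol_cis_nonpos:
  assumes \<gamma>: "1 < \<gamma>" "\<gamma> < 2" and \<theta>: "0 < \<theta>" "\<theta> \<le> pi"
  shows "Re (cnj (cis \<theta>) * gen_base \<gamma> (cis \<theta>) powr of_real \<gamma>) \<le> 0"
proof -
  define s where "s = (2 - \<gamma>) / (2 * \<gamma>)"
  have s: "0 < s" "s < 1 / 2" using \<gamma> by (auto simp: s_def field_simps)
  have \<gamma>s: "\<gamma> * s = 1 - \<gamma> / 2" using \<gamma> by (simp add: s_def field_simps)
  define q where "q = of_real (1 - s) + of_real s * cis \<theta>"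
  define \<phi> where "\<phi> = Arg q"
  have Re_q: "Re q > 0"
  proof -
    have "s * (-1) \<le> s * cos \<theta>" using s by (intro mult_left_mono) auto
    then show ?thesis using s by (simp add: q_def)
  qed
  have q0: "q \<noteq> 0" using Re_q by auto
  have "Im q \<ge> 0" using s \<theta> by (simp add: q_def sin_ge_zero)
  then have \<phi>: "0 \<le> \<phi>" "\<phi> < pi / 2"
    using Re_q Arg_less_0[of q] Arg_Re_pos[of q] by (auto simp: \<phi>_def)
  have q_polar: "q = of_real (norm q) * cis \<phi>"
    using q0 by (simp add: \<phi>_def cis_Arg sgn_div_norm scaleR_conv_of_real)
  \<comment> \<open>Rotating \<open>q\<close> by \<open>- s \<theta>\<close> moves it to or below the real axis.\<close>
  have \<phi>_le: "\<phi> \<le> s * \<theta>"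
  proof (rule ccontr)
    assume "\<not> \<phi> \<le> s * \<theta>"
    then have "sin (\<phi> - s * \<theta>) > 0"
      using \<phi> s \<theta> by (intro sin_gt_zero) (auto intro: order.strict_trans2[of _ \<phi>] simp: less_diff_eq)
    then have "norm q * sin (\<phi> - s * \<theta>) > 0" using q0 by simp
    also have "norm q * sin (\<phi> - s * \<theta>) = Im (q * cis (- (s * \<theta>)))"
      by (subst q_polar) (simp add: sin_diff algebra_simps)
    also have "\<dots> = s * sin ((1 - s) * \<theta>) - (1 - s) * sin (s * \<theta>)"
      by (simp add: q_def sin_diff algebra_simps)
    finally show False using sin_scaled_le[of s \<theta>] s \<theta> by simp
  qed
  define \<psi> where "\<psi> = (\<theta> - pi) / 2 + \<phi>"
  define R where "R = 2 * sin (\<theta> / 2) * norm q"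
  have "sin (\<theta> / 2) > 0" using \<theta> by (intro sin_gt_zero) auto
  then have R: "R > 0" using q0 by (simp add: R_def)
  have base: "gen_base \<gamma> (cis \<theta>) = of_real R * cis \<psi>"
  proof -
    have "gen_base \<gamma> (cis \<theta>) = (1 - cis \<theta>) * q"
      using gen_base_factor_affine[OF \<gamma>(1)] by (simp add: q_def s_def)
    also have "\<dots> = of_real R * (cis ((\<theta> - pi) / 2) * cis \<phi>)"
      by (subst q_polar) (simp add: one_minus_cis R_def)
    finally show ?thesis by (simp only: cis_mult \<psi>_def)
  qed
  have "Ln (of_real R * cis \<psi>) = of_real (ln R) + \<i> * of_real \<psi>"
  proof -
    have "of_real R * cis \<psi> = exp (of_real (ln R) + \<i> * of_real \<psi>)"
      using R by (simp add: exp_add cis_conv_exp exp_of_real)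
    moreover have "- pi < \<psi>" using \<phi> \<theta> pi_gt_zero unfolding \<psi>_def by argo
    moreover have "\<psi> \<le> pi" using \<phi> \<theta> pi_gt_zero unfolding \<psi>_def by argo
    ultimately show ?thesis by (simp add: Ln_exp)
  qed
  then have "gen_base \<gamma> (cis \<theta>) powr of_real \<gamma> = exp (of_real (\<gamma> * ln R) + \<i> * of_real (\<gamma> * \<psi>))"
    using R by (simp add: base powr_def algebra_simps)
  also have "\<dots> = of_real (exp (\<gamma> * ln R)) * cis (\<gamma> * \<psi>)"
    by (simp add: exp_add cis_conv_exp flip: exp_of_real)
  finally have "Re (cnj (cis \<theta>) * gen_base \<gamma> (cis \<theta>) powr of_real \<gamma>)
      = exp (\<gamma> * ln R) * cos (\<theta> - \<gamma> * \<psi>)"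
    by (simp add: cos_diff algebra_simps)
  moreover have "cos (\<theta> - \<gamma> * \<psi>) \<le> 0"
  proof -
    have "\<gamma> * \<phi> \<le> (1 - \<gamma> / 2) * \<theta>"
      using mult_left_mono[OF \<phi>_le, of \<gamma>] \<gamma> by (simp add: \<gamma>s flip: mult.assoc)
    then have "\<gamma> * pi / 2 \<le> \<theta> - \<gamma> * \<psi>" by (simp add: \<psi>_def field_simps)
    moreover have "1 * pi \<le> \<gamma> * pi" using \<gamma> by (intro mult_right_mono) auto
    ultimately have lower: "pi / 2 \<le> \<theta> - \<gamma> * \<psi>" by linarith
    have "(1 - \<gamma> / 2) * \<theta> \<le> (1 - \<gamma> / 2) * pi" using \<gamma> \<theta> by (intro mult_left_mono) auto
    moreover have "0 \<le> \<gamma> * \<phi>" using \<gamma> \<phi> by simp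
    ultimately have upper: "\<theta> - \<gamma> * \<psi> \<le> pi" by (simp add: \<psi>_def field_simps)
    have "cos (\<theta> - \<gamma> * \<psi>) \<le> cos (pi / 2)"
      using lower upper by (intro cos_monotone_0_pi_le) auto
    then show ?thesis by simp
  qed
  ultimately show ?thesis by (simp add: mult_nonneg_nonpos)
qed

text \<open>
  On the closed disc the base meets the branch cut only at \<open>z = 1\<close>, where it vanishes.
  Elsewhere it is the product of two numbers in the open right half-plane, whose arguments add up to
  less than \<open>\<pi>\<close> in absolute value.
\<close>

lemma gen_base_not_nonpos_closed:
  assumes \<gamma>: "1 < \<gamma>" "\<gamma> < 2" and z: "norm z \<le> 1" "z \<noteq> 1"
  shows "gen_base \<gamma> z \<notin> \<real>\<^sub>\<le>\<^sub>0"
proof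
  define s where "s = (2 - \<gamma>) / (2 * \<gamma>)"
  have s: "0 < s" "s < 1 / 2" using \<gamma> by (auto simp: s_def field_simps)
  define p q where "p = 1 - z" and "q = of_real (1 - s) + of_real s * z"
  have "Re z \<noteq> 1"
  proof
    assume "Re z = 1"
    moreover from this have "Im z = 0" 
      using z(1) cmod_power2[of z] by (smt (verit) one_power2 power2_less_0 power_mono norm_ge_zero zero_eq_power2 zero_le_power2)
    ultimately show False using z(2) by (simp add: complex_eq_iff)
  qed
  then have p: "Re p > 0" using z complex_Re_le_cmod[of z] by (simp add: p_def)
  have "s * (-1) \<le> s * Re z"
    using s z abs_Re_le_cmod[of z] by (intro mult_left_mono) auto
  then have q: "Re q > 0" using s by (simp add: q_def)
  assume "gen_base \<gamma> z \<in> \<real>\<^sub>\<le>\<^sub>0"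
  then have "p * q \<in> \<real>\<^sub>\<le>\<^sub>0"
    using gen_base_factor_affine[OF \<gamma>(1), of z] by (simp add: p_def q_def s_def)
  then have im: "Im p * Re q = - (Re p * Im q)" and re: "Re p * Re q \<le> Im p * Im q"
    by (auto simp: complex_nonpos_Reals_iff algebra_simps)
  have "Re p * Re q * Re q \<le> Im p * Im q * Re q"
    using re q by (intro mult_right_mono) auto
  also have "\<dots> = - (Re p * (Im q)\<^sup>2)"
    using im by (metis (no_types, opaque_lifting) mult.assoc mult.commute mult_minus_left power2_eq_square)
  also have "\<dots> \<le> 0" using p by simp
  finally show False using p q by (simp add: mult_le_0_iff)
qed

lemma Re_symbol_nonpos:
  assumes \<gamma>: "1 < \<gamma>" "\<gamma> < 2" and z: "norm z = 1"
  shows "Re (cnj z * gen_base \<gamma> z powr of_real \<gamma>) \<le> 0"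
proof -
  have z_cis: "z = cis (Arg z)" using z cis_Arg[of z] by (cases "z = 0") (auto simp: sgn_div_norm)
  consider "z = 1" | "z \<noteq> 1" "0 < Arg z" | "z \<noteq> 1" "Arg z < 0"
    using z_cis by (metis cis_zero linorder_neqE_linordered_idom)
  then show ?thesis
  proof cases
    case 1
    then show ?thesis by (simp add: gen_base_factor_affine[OF \<gamma>(1)])
  next
    case 2
    then show ?thesis
      using Re_symbol_cis_nonpos[OF \<gamma>, of "Arg z"] Arg_le_pi[of z] z_cis by metis
  next
    case 3
    have "cnj (gen_base \<gamma> z powr of_real \<gamma>) = gen_base \<gamma> (cnj z) powr of_real \<gamma>"
    proof -
      have "gen_base \<gamma> z \<notin> \<real>\<^sub>\<le>\<^sub>0" using gen_base_not_nonpos_closed[OF \<gamma>, of z] z 3 by simp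
      moreover have "cnj (gen_base \<gamma> z) = gen_base \<gamma> (cnj z)" by (simp add: gen_base_def)
      ultimately show ?thesis by (subst cnj_powr) (auto simp: complex_nonpos_Reals_iff)
    qed
    moreover have "cnj z = cis (- Arg z)" using z_cis by (metis cis_cnj)
    moreover have "Re (cnj (cis (- Arg z)) * gen_base \<gamma> (cis (- Arg z)) powr of_real \<gamma>) \<le> 0"
      using 3 mpi_less_Arg[of z] by (intro Re_symbol_cis_nonpos[OF \<gamma>]) auto
    ultimately have "Re (cnj (cnj z * gen_base \<gamma> z powr of_real \<gamma>)) \<le> 0" by simp
    then show ?thesis by simp
  qed
qed

text \<open>
  Continuity persists at the zero \<open>z = 1\<close> of the base because the exponent is positive.
\<close>

lemma continuous_on_gen_base_powr:
  assumes \<gamma>: "1 < \<gamma>" "\<gamma> < 2"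
  shows "continuous_on (cball 0 1) (\<lambda>z. gen_base \<gamma> z powr of_real \<gamma>)"
proof (rule continuous_on_powr_complex)
  show "cball 0 1 \<subseteq> {z. Re (gen_base \<gamma> z) \<ge> 0 \<or> Im (gen_base \<gamma> z) \<noteq> 0}"
    using gen_base_not_nonpos_closed[OF \<gamma>]
    by (force simp: complex_nonpos_Reals_iff gen_base_factor_affine[OF \<gamma>(1)])
  show "continuous_on (cball 0 1) (gen_base \<gamma>)"
    unfolding gen_base_def by (intro continuous_intros)
qed (use \<gamma> in \<open>auto intro: continuous_intros\<close>)


section \<open>Toeplitz forms on the unit circle\<close>

lemma sum_roots_of_unity_orthogonal:
  assumes "a < N" "b < N"
  shows "(\<Sum>s<N. cis (2 * pi * real s / real N) ^ a * cnj (cis (2 * pi * real s / real N)) ^ b)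
    = (if a = b then of_nat N else 0)"
proof -
  define t where "t = 2 * pi * (real a - real b) / real N"
  have N: "N > 0" using assms by simp
  have "(\<Sum>s<N. cis (2 * pi * real s / real N) ^ a * cnj (cis (2 * pi * real s / real N)) ^ b)
      = (\<Sum>s<N. cis t ^ s)"
    using N by (intro sum.cong refl) (simp add: cis_cnj Complex.DeMoivre cis_mult t_def field_simps)
  also have "\<dots> = (if a = b then of_nat N else 0)"
  proof (cases "a = b")
    case False
    have "cis t \<noteq> 1"
    proof
      assume "cis t = 1"
      then have "cos t = 1" by (simp add: complex_eq_iff)
      then obtain k :: int where "t = of_int k * 2 * pi" by (auto simp: cos_one_2pi_int)
      then have "2 * pi * (real a - real b) = 2 * pi * (real_of_int k * real N)"
        using N by (simp add: t_def divide_eq_eq mult_ac)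
      then have "real a - real b = real_of_int k * real N"
        by (subst (asm) mult_left_cancel) auto
      then have "real_of_int (int a - int b) = real_of_int (k * int N)" by simp
      then have eq: "int a - int b = k * int N" by (simp only: of_int_eq_iff)
      have "\<bar>k * int N\<bar> < int N" using assms by (simp flip: eq)
      then have "k = 0" using N by (simp add: abs_mult)
      then show False using eq False by simp
    qed
    moreover have "cis t ^ N = 1"
    proof -
      have "cis t ^ N = cis (2 * pi * of_int (int a - int b))"
        using N by (simp add: Complex.DeMoivre t_def)
      then show ?thesis by (simp only: cis_multiple_2pi Ints_of_int)
    qed
    ultimately show ?thesis using False by (simp add: geometric_sum)
  qed (simp add: t_def)
  finally show ?thesis .
qed

text \<open>
  A Toeplitz form whose symbol is \<open>1 / z\<close> times a polynomial is at most the sum of squares times the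
  supremum of the real part of that symbol. With \<open>W(z) = \<Sum>m<M. w m * z ^ m\<close>, averaging the symbol
  times \<open>\<bar>W\<bar>\<^sup>2\<close> over sufficiently many roots of unity extracts the form exactly, and averaging \<open>\<bar>W\<bar>\<^sup>2\<close>
  gives the sum of squares.
\<close>

lemma Toeplitz_form_le:
  fixes c w :: "nat \<Rightarrow> real"
  assumes symbol: "\<And>z::complex. norm z = 1 \<Longrightarrow> Re (cnj z * (\<Sum>l\<le>n. of_real (c l) * z ^ l)) \<le> \<epsilon>"
    and "M \<le> n"
  shows "(\<Sum>i<M. \<Sum>m<M. if m \<le> i + 1 then c (i + 1 - m) * w m * w i else 0) \<le> \<epsilon> * (\<Sum>i<M. (w i)\<^sup>2)"
proof -
  \<comment> \<open>All exponents below are at most \<open>n + M\<close>, so that no two different ones agree modulo \<open>N\<close>.\<close>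
  define N where "N = n + M + 2"
  define \<zeta> where "\<zeta> = (\<lambda>s. cis (2 * pi * real s / real N))"
  define p where "p = (\<lambda>z::complex. \<Sum>l\<le>n. of_real (c l) * z ^ l)"
  define W where "W = (\<lambda>z::complex. \<Sum>m<M. of_real (w m) * z ^ m)"
  have norm_\<zeta>: "norm (\<zeta> s) = 1" for s by (simp add: \<zeta>_def)
  have orth: "(\<Sum>s<N. \<zeta> s ^ a * cnj (\<zeta> s) ^ b) = (if a = b then of_nat N else 0)"
    if "a < N" "b < N" for a b
    using sum_roots_of_unity_orthogonal[OF that] by (simp add: \<zeta>_def)
  have norm_W: "(\<Sum>s<N. W (\<zeta> s) * cnj (W (\<zeta> s))) = of_nat N * of_real (\<Sum>i<M. (w i)\<^sup>2)"
  proof -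
    have "(\<Sum>s<N. W (\<zeta> s) * cnj (W (\<zeta> s))) =
        (\<Sum>s<N. \<Sum>m<M. \<Sum>i<M. of_real (w m * w i) * (\<zeta> s ^ m * cnj (\<zeta> s) ^ i))"
      by (simp add: W_def sum_product mult_ac)
    also have "\<dots> = (\<Sum>m<M. \<Sum>i<M. of_real (w m * w i) * (\<Sum>s<N. \<zeta> s ^ m * cnj (\<zeta> s) ^ i))"
      unfolding sum_distrib_left
      by (subst sum.swap, rule sum.cong[OF refl], subst sum.swap) (rule refl)
    also have "\<dots> = (\<Sum>m<M. \<Sum>i<M. of_real (w m * w i) * (if m = i then of_nat N else 0))"
      by (intro sum.cong refl arg_cong2[where f = "(*)"] orth) (auto simp: N_def)
    also have "\<dots> = (\<Sum>m<M. of_real (w m * w m) * of_nat N)"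
      by (simp add: if_distrib[of "(*) _"] cong: if_cong)
    finally show ?thesis by (simp add: sum_distrib_left power2_eq_square mult_ac)
  qed
  have form: "(\<Sum>s<N. cnj (\<zeta> s) * p (\<zeta> s) * (W (\<zeta> s) * cnj (W (\<zeta> s)))) =
      of_nat N * of_real (\<Sum>i<M. \<Sum>m<M. if m \<le> i + 1 then c (i + 1 - m) * w m * w i else 0)"
  proof -
    have "(\<Sum>s<N. cnj (\<zeta> s) * p (\<zeta> s) * (W (\<zeta> s) * cnj (W (\<zeta> s)))) =
        (\<Sum>s<N. (\<Sum>l\<le>n. of_real (c l) * \<zeta> s ^ l) *
          (\<Sum>m<M. \<Sum>i<M. of_real (w m * w i) * (\<zeta> s ^ m * cnj (\<zeta> s) ^ (i + 1))))"
    proof (rule sum.cong[OF refl])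
      fix s
      have *: "cnj (\<zeta> s) * (W (\<zeta> s) * cnj (W (\<zeta> s))) =
          (\<Sum>m<M. \<Sum>i<M. of_real (w m * w i) * (\<zeta> s ^ m * cnj (\<zeta> s) ^ (i + 1)))"
      proof -
        have "W (\<zeta> s) * cnj (W (\<zeta> s)) =
            (\<Sum>m<M. \<Sum>i<M. of_real (w m * w i) * (\<zeta> s ^ m * cnj (\<zeta> s) ^ i))"
          unfolding W_def cnj_sum sum_product by (intro sum.cong refl) simp
        then show ?thesis
          by (simp only: sum_distrib_left) (intro sum.cong refl, simp add: mult_ac)
      qed
      have "cnj (\<zeta> s) * p (\<zeta> s) * (W (\<zeta> s) * cnj (W (\<zeta> s))) =
          p (\<zeta> s) * (cnj (\<zeta> s) * (W (\<zeta> s) * cnj (W (\<zeta> s))))"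
        by (simp only: mult_ac)
      then show "cnj (\<zeta> s) * p (\<zeta> s) * (W (\<zeta> s) * cnj (W (\<zeta> s))) =
          (\<Sum>l\<le>n. of_real (c l) * \<zeta> s ^ l) *
          (\<Sum>m<M. \<Sum>i<M. of_real (w m * w i) * (\<zeta> s ^ m * cnj (\<zeta> s) ^ (i + 1)))"
        by (simp only: * p_def)
    qed
    also have "\<dots> = (\<Sum>s<N. \<Sum>i<M. \<Sum>m<M. \<Sum>l\<le>n.
        of_real (c l * w m * w i) * (\<zeta> s ^ (l + m) * cnj (\<zeta> s) ^ (i + 1)))"
    proof (rule sum.cong[OF refl])
      fix s
      have "(\<Sum>l\<le>n. of_real (c l) * \<zeta> s ^ l) *
          (\<Sum>m<M. \<Sum>i<M. of_real (w m * w i) * (\<zeta> s ^ m * cnj (\<zeta> s) ^ (i + 1))) =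
        (\<Sum>m<M. \<Sum>i<M. \<Sum>l\<le>n.
          of_real (c l * w m * w i) * (\<zeta> s ^ (l + m) * cnj (\<zeta> s) ^ (i + 1)))"
        by (simp add: sum_distrib_left sum_distrib_right power_add mult_ac)
      then show "(\<Sum>l\<le>n. of_real (c l) * \<zeta> s ^ l) *
          (\<Sum>m<M. \<Sum>i<M. of_real (w m * w i) * (\<zeta> s ^ m * cnj (\<zeta> s) ^ (i + 1))) =
        (\<Sum>i<M. \<Sum>m<M. \<Sum>l\<le>n.
          of_real (c l * w m * w i) * (\<zeta> s ^ (l + m) * cnj (\<zeta> s) ^ (i + 1)))"
        by (subst sum.swap)
    qed
    also have "\<dots> = (\<Sum>i<M. \<Sum>m<M. \<Sum>l\<le>n.
        of_real (c l * w m * w i) * (\<Sum>s<N. \<zeta> s ^ (l + m) * cnj (\<zeta> s) ^ (i + 1)))"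
      unfolding sum_distrib_left
      by (subst sum.swap, rule sum.cong[OF refl], subst sum.swap, rule sum.cong[OF refl],
          subst sum.swap) (rule refl)
    also have "\<dots> = (\<Sum>i<M. \<Sum>m<M. \<Sum>l\<le>n.
        of_real (c l * w m * w i) * (if l + m = i + 1 then of_nat N else 0))"
      by (intro sum.cong refl arg_cong2[where f = "(*)"] orth) (auto simp: N_def)
    also have "\<dots> = (\<Sum>i<M. \<Sum>m<M.
        of_nat N * of_real (if m \<le> i + 1 then c (i + 1 - m) * w m * w i else 0))"
    proof (intro sum.cong refl)
      fix i m assume im: "i \<in> {..<M}" "m \<in> {..<M}"
      have "(\<Sum>l\<le>n. of_real (c l * w m * w i) * (if l + m = i + 1 then of_nat N else 0)) =
          (\<Sum>l\<le>n. if m \<le> i + 1 \<and> l = i + 1 - m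
             then of_nat N * complex_of_real (c (i + 1 - m) * w m * w i) else 0)"
        by (intro sum.cong refl) auto
      also have "\<dots> = of_nat N * of_real (if m \<le> i + 1 then c (i + 1 - m) * w m * w i else 0)"
        using im \<open>M \<le> n\<close> by (cases "m \<le> i + 1") (auto simp: sum.delta)
      finally show "(\<Sum>l\<le>n. of_real (c l * w m * w i) * (if l + m = i + 1 then of_nat N else 0)) =
          of_nat N * complex_of_real (if m \<le> i + 1 then c (i + 1 - m) * w m * w i else 0)" .
    qed
    finally show ?thesis by (simp add: sum_distrib_left)
  qed
  have Re_mult: "Re (x * of_real r) = Re x * r" for x :: complex and r :: real by simp
  have "real N * (\<Sum>i<M. \<Sum>m<M. if m \<le> i + 1 then c (i + 1 - m) * w m * w i else 0) =
      Re (\<Sum>s<N. cnj (\<zeta> s) * p (\<zeta> s) * (W (\<zeta> s) * cnj (W (\<zeta> s))))"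
    unfolding form by simp
  also have "\<dots> = (\<Sum>s<N. Re (cnj (\<zeta> s) * p (\<zeta> s)) * (norm (W (\<zeta> s)))\<^sup>2)"
    unfolding Re_sum complex_norm_square[symmetric]
    by (simp only: Re_mult)
  also have "\<dots> \<le> (\<Sum>s<N. \<epsilon> * (norm (W (\<zeta> s)))\<^sup>2)"
    using symbol norm_\<zeta> by (intro sum_mono mult_right_mono) (auto simp: p_def)
  also have "\<dots> = \<epsilon> * Re (\<Sum>s<N. W (\<zeta> s) * cnj (W (\<zeta> s)))"
    unfolding complex_norm_square[symmetric] sum_distrib_left Re_sum by (simp flip: of_real_power)
  also have "\<dots> = real N * (\<epsilon> * (\<Sum>i<M. (w i)\<^sup>2))"
    unfolding norm_W by simp
  finally show ?thesis by (simp add: N_def)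
qed

text \<open>
  The coefficients \<open>\<kappa>\<^sub>2\<close> are those of a power series that is known to converge only inside the disc.
  Replacing \<open>\<kappa>\<^sub>2 \<gamma> l\<close> by \<open>\<kappa>\<^sub>2 \<gamma> l * \<rho> ^ l\<close> with \<open>\<rho> < 1\<close> makes it converge uniformly on the circle, where
  its values approach the boundary values uniformly as \<open>\<rho>\<close> tends to \<open>1\<close>.
\<close>

lemma kappa_form_nonpos:
  fixes w :: "nat \<Rightarrow> real"
  assumes \<gamma>: "1 < \<gamma>" "\<gamma> < 2"
  shows "(\<Sum>i<M. \<Sum>m<M. if m \<le> i + 1 then \<kappa>\<^sub>2 \<gamma> (i + 1 - m) * w m * w i else 0) \<le> 0"
proof -
  define g where "g = (\<lambda>z. gen_base \<gamma> z powr of_real \<gamma>)"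
  define S where "S = (\<Sum>i<M. (w i)\<^sup>2)"
  define Q where "Q = (\<lambda>\<rho>. \<Sum>i<M. \<Sum>m<M.
    if m \<le> i + 1 then (\<kappa>\<^sub>2 \<gamma> (i + 1 - m) * \<rho> ^ (i + 1 - m)) * w m * w i else 0)"
  have Q_near_1: "\<exists>\<delta>>0. \<forall>\<rho>. 0 < \<rho> \<longrightarrow> \<rho> < 1 \<longrightarrow> 1 - \<rho> < \<delta> \<longrightarrow> Q \<rho> \<le> \<epsilon> * S" if "\<epsilon> > 0" for \<epsilon>
  proof -
    have "uniformly_continuous_on (cball 0 1) g"
      using continuous_on_gen_base_powr[OF \<gamma>]
      by (intro compact_uniformly_continuous) (auto simp: g_def)
    then obtain \<delta> where \<delta>: "\<delta> > 0"
        "\<And>x y. x \<in> cball 0 1 \<Longrightarrow> y \<in> cball 0 1 \<Longrightarrow> dist y x < \<delta> \<Longrightarrow> dist (g y) (g x) < \<epsilon> / 2"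
      unfolding uniformly_continuous_on_def using \<open>\<epsilon> > 0\<close> by (metis half_gt_zero)
    have "Q \<rho> \<le> \<epsilon> * S" if \<rho>: "0 < \<rho>" "\<rho> < 1" "1 - \<rho> < \<delta>" for \<rho>
    proof -
      define c where "c = (\<lambda>l. \<kappa>\<^sub>2 \<gamma> l * \<rho> ^ l)"
      have sums: "(\<lambda>l. of_real (c l) * z ^ l) sums g (of_real \<rho> * z)" if "norm z = 1" for z :: complex
        using kappa_sums[OF \<gamma>, of "of_real \<rho> * z"] that \<rho>
        by (simp add: norm_mult c_def g_def power_mult_distrib mult_ac)
      have "summable (\<lambda>l. norm (c l))"
      proof -
        obtain r where r: "\<rho> < r" "r < 1" using dense \<rho>(2) by blast
        have "summable (\<lambda>l. of_real (\<kappa>\<^sub>2 \<gamma> l) * (of_real r :: complex) ^ l)"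
          using kappa_sums[OF \<gamma>, of "of_real r"] r \<rho> by (auto simp: sums_iff)
        then have "summable (\<lambda>l. norm (of_real (\<kappa>\<^sub>2 \<gamma> l) * (of_real \<rho> :: complex) ^ l))"
          by (rule powser_insidea) (use r \<rho> in auto)
        then show ?thesis by (simp add: c_def norm_mult norm_power abs_mult power_abs)
      qed
      then have "uniform_limit (sphere 0 1) (\<lambda>n z. \<Sum>l<n. of_real (c l) * (z::complex) ^ l)
          (\<lambda>z. \<Sum>l. of_real (c l) * z ^ l) sequentially"
        by (intro Weierstrass_m_test[where M = "\<lambda>l. norm (c l)"]) (auto simp: norm_mult norm_power)
      then have "\<forall>\<^sub>F n in sequentially. \<forall>z\<in>sphere 0 1.
          dist (\<Sum>l<n. of_real (c l) * (z::complex) ^ l) (\<Sum>l. of_real (c l) * z ^ l) < \<epsilon> / 2"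
        using \<open>\<epsilon> > 0\<close> by (intro uniform_limitD) auto
      then obtain n0 where n0: "\<forall>n\<ge>n0. \<forall>z\<in>sphere 0 1.
          dist (\<Sum>l<n. of_real (c l) * (z::complex) ^ l) (\<Sum>l. of_real (c l) * z ^ l) < \<epsilon> / 2"
        unfolding eventually_sequentially by blast
      define n where "n = max n0 M"
      have symbol: "Re (cnj z * (\<Sum>l\<le>n. of_real (c l) * z ^ l)) \<le> \<epsilon>" if z: "norm z = 1" for z :: complex
      proof -
        let ?p = "\<Sum>l\<le>n. of_real (c l) * z ^ l"
        have "dist ?p (g (of_real \<rho> * z)) < \<epsilon> / 2"
          using n0[rule_format, of "Suc n" z] z sums[OF z] by (simp add: n_def sums_iff lessThan_Suc_atMost)
        moreover have "dist (g (of_real \<rho> * z)) (g z) < \<epsilon> / 2"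
        proof (rule \<delta>(2))
          have "dist (of_real \<rho> * z) z = norm ((of_real \<rho> - 1) * z)"
            by (simp add: dist_norm algebra_simps)
          also have "\<dots> = norm (complex_of_real (\<rho> - 1))" using z by (simp add: norm_mult)
          also have "\<dots> = \<bar>\<rho> - 1\<bar>" by (rule norm_of_real)
          finally show "dist (of_real \<rho> * z) z < \<delta>" using \<rho> by simp
        qed (use z \<rho> in \<open>auto simp: norm_mult\<close>)
        ultimately have "norm (?p - g z) < \<epsilon>"
          using dist_triangle[of ?p "g z" "g (of_real \<rho> * z)"] by (simp add: dist_norm)
        then have "norm (cnj z * (?p - g z)) < \<epsilon>" using z by (simp add: norm_mult)
        then have "Re (cnj z * (?p - g z)) < \<epsilon>"
          using complex_Re_le_cmod order.strict_trans1 by blast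
        moreover have "Re (cnj z * g z) \<le> 0" using Re_symbol_nonpos[OF \<gamma> z] by (simp add: g_def)
        ultimately show ?thesis by (simp add: right_diff_distrib)
      qed
      then show ?thesis
        using Toeplitz_form_le[OF symbol, where M = M and w = w]
        by (simp only: Q_def c_def S_def n_def max.cobounded2)
    qed
    with \<delta>(1) show ?thesis by blast
  qed
  have "S \<ge> 0" by (simp add: S_def sum_nonneg)
  have Q_1: "Q 1 \<le> \<epsilon> * S" if \<epsilon>: "\<epsilon> > 0" for \<epsilon>
  proof (rule tendsto_upperbound)
    have "isCont (\<lambda>\<rho>. if m \<le> i + 1 then (\<kappa>\<^sub>2 \<gamma> (i + 1 - m) * \<rho> ^ (i + 1 - m)) * w m * w i else 0) 1"
      for i m
      by (cases "m \<le> i + 1") (simp_all add: continuous_intros)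
    then have "isCont Q 1"
      unfolding Q_def by (intro continuous_sum)
    then show "(Q \<longlongrightarrow> Q 1) (at_left 1)"
      by (simp add: isCont_def filterlim_at_split)
    obtain \<delta> where "\<delta> > 0" "\<And>\<rho>. 0 < \<rho> \<Longrightarrow> \<rho> < 1 \<Longrightarrow> 1 - \<rho> < \<delta> \<Longrightarrow> Q \<rho> \<le> \<epsilon> * S"
      using Q_near_1[OF \<epsilon>] by blast
    then show "\<forall>\<^sub>F \<rho> in at_left 1. Q \<rho> \<le> \<epsilon> * S"
      unfolding eventually_at_left_field by (intro exI[of _ "max 0 (1 - \<delta>)"]) auto
  qed simp
  have "Q 1 \<le> 0 + \<epsilon>" if "\<epsilon> > 0" for \<epsilon>
  proof -
    have "Q 1 \<le> \<epsilon> / (S + 1) * S"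
      using that \<open>S \<ge> 0\<close> by (intro Q_1 divide_pos_pos) auto
    also have "\<dots> \<le> \<epsilon>" using that \<open>S \<ge> 0\<close> by (simp add: field_simps)
    finally show ?thesis by simp
  qed
  then have "Q 1 \<le> 0" by (rule field_le_epsilon)
  then show ?thesis by (simp only: Q_def power_one mult_1_right)
qed


section \<open>One-dimensional quadratic forms\<close>

lemma sum_lessThan_interior:
  fixes h :: "nat \<Rightarrow> real"
  assumes "h 0 = 0"
  shows "(\<Sum>i<M. h i) = (\<Sum>i=1..M - 1. h i)"
  using assms by (intro sum.mono_neutral_right) (auto simp: not_less_eq_eq)

lemma sum_shift_interior:
  fixes h :: "nat \<Rightarrow> real"
  assumes "h M = 0"
  shows "(\<Sum>i<M. h (Suc i)) = (\<Sum>i=1..M - 1. h i)"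
proof -
  have "(\<Sum>i<M. h (Suc i)) = (\<Sum>i=1..M. h i)"
    by (rule sum.reindex_bij_witness[of _ "\<lambda>i. i - 1" Suc]) auto
  also have "\<dots> = (\<Sum>i=1..M - 1. h i)"
  proof (rule sum.mono_neutral_right)
    show "\<forall>i\<in>{1..M} - {1..M - 1}. h i = 0"
    proof
      fix i assume "i \<in> {1..M} - {1..M - 1}"
      then have "i = M" by auto
      then show "h i = 0" using assms by simp
    qed
  qed auto
  finally show ?thesis .
qed

text \<open>
  The two sums are the Toeplitz matrix of \<open>kappa_form_nonpos\<close> and its transpose, and these have the
  same quadratic form.
\<close>

lemma kappa_two_sided_form_nonpos:
  fixes x :: "nat \<Rightarrow> real"
  assumes \<gamma>: "1 < \<gamma>" "\<gamma> < 2" and x: "x 0 = 0" "x M = 0"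
  shows "(\<Sum>i=1..M - 1. x i * ((\<Sum>l=0..i + 1. \<kappa>\<^sub>2 \<gamma> l * x (i + 1 - l)) +
      (\<Sum>l=0..M - i + 1. \<kappa>\<^sub>2 \<gamma> l * x (i + l - 1)))) \<le> 0"
proof -
  let ?t = "\<lambda>i m. if m \<le> i + 1 then \<kappa>\<^sub>2 \<gamma> (i + 1 - m) * x m * x i else 0"
  have to_all: "(\<Sum>i=1..M - 1. x i * F i) = (\<Sum>i<M. x i * F i)" for F
    using sum_lessThan_interior[of "\<lambda>i. x i * F i" M] x by simp
  have left: "x i * (\<Sum>l=0..i + 1. \<kappa>\<^sub>2 \<gamma> l * x (i + 1 - l)) = (\<Sum>m<M. ?t i m)" if "i < M" for i
  proof -
    have "(\<Sum>l=0..i + 1. \<kappa>\<^sub>2 \<gamma> l * x (i + 1 - l)) = (\<Sum>m=0..i + 1. \<kappa>\<^sub>2 \<gamma> (i + 1 - m) * x m)"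
      by (rule sum.reindex_bij_witness[of _ "\<lambda>m. i + 1 - m" "\<lambda>l. i + 1 - l"]) auto
    then have "x i * (\<Sum>l=0..i + 1. \<kappa>\<^sub>2 \<gamma> l * x (i + 1 - l)) = (\<Sum>m=0..i + 1. ?t i m)"
      by (simp only: sum_distrib_left) (intro sum.cong refl, simp)
    also have "\<dots> = (\<Sum>m\<le>M. ?t i m)"
      using that by (intro sum.mono_neutral_left) auto
    also have "\<dots> = (\<Sum>m<M. ?t i m)"
      using x by (simp flip: lessThan_Suc_atMost)
    finally show ?thesis .
  qed
  have right: "x i * (\<Sum>l=0..M - i + 1. \<kappa>\<^sub>2 \<gamma> l * x (i + l - 1)) = (\<Sum>m<M. ?t m i)" if "i < M" for i
  proof (cases "i = 0")
    case False
    have "(\<Sum>l=0..M - i + 1. \<kappa>\<^sub>2 \<gamma> l * x (i + l - 1)) = (\<Sum>m=i - 1..M. \<kappa>\<^sub>2 \<gamma> (m + 1 - i) * x m)"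
      using that False
      by (intro sum.reindex_bij_witness[of _ "\<lambda>m. m + 1 - i" "\<lambda>l. i + l - 1"]) auto
    then have "x i * (\<Sum>l=0..M - i + 1. \<kappa>\<^sub>2 \<gamma> l * x (i + l - 1)) = (\<Sum>m=i - 1..M. ?t m i)"
      by (auto simp: sum_distrib_left mult_ac intro!: sum.cong)
    also have "\<dots> = (\<Sum>m\<le>M. ?t m i)"
      using that False by (intro sum.mono_neutral_left) auto
    also have "\<dots> = (\<Sum>m<M. ?t m i)"
      using x by (simp flip: lessThan_Suc_atMost)
    finally show ?thesis .
  qed (simp add: x)
  have "(\<Sum>i=1..M - 1. x i * ((\<Sum>l=0..i + 1. \<kappa>\<^sub>2 \<gamma> l * x (i + 1 - l)) +
      (\<Sum>l=0..M - i + 1. \<kappa>\<^sub>2 \<gamma> l * x (i + l - 1)))) = (\<Sum>i<M. (\<Sum>m<M. ?t i m) + (\<Sum>m<M. ?t m i))"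
    unfolding to_all using left right by (intro sum.cong refl) (simp only: distrib_left lessThan_iff)
  also have "\<dots> = (\<Sum>i<M. \<Sum>m<M. ?t i m) + (\<Sum>i<M. \<Sum>m<M. ?t m i)"
    by (rule sum.distrib)
  also have "(\<Sum>i<M. \<Sum>m<M. ?t m i) = (\<Sum>i<M. \<Sum>m<M. ?t i m)"
    by (rule sum.swap)
  finally show ?thesis using kappa_form_nonpos[OF \<gamma>, where M = M and w = x] by simp
qed

text \<open>
  The bidiagonal factor of the tridiagonal operator \<open>y \<mapsto> y i + \<sigma> (y (i + 1) - 2 y i + y (i - 1))\<close>. Its
  two coefficients have sum \<open>1\<close> and, for \<open>\<sigma> \<le> 1 / 4\<close>, product \<open>\<sigma>\<close>.
\<close>

definition bidiag :: "real \<Rightarrow> (nat \<Rightarrow> real) \<Rightarrow> nat \<Rightarrow> real" where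
  "bidiag \<sigma> x i = (1 + sqrt (1 - 4 * \<sigma>)) / 2 * x i + (1 - sqrt (1 - 4 * \<sigma>)) / 2 * x (i + 1)"

lemma bidiag_eq:
  assumes "\<sigma> \<le> 1 / 4"
  obtains p q where "bidiag \<sigma> = (\<lambda>x i. p * x i + q * x (i + 1))"
    "p + q = 1" "p * q = \<sigma>" "(p - q)\<^sup>2 = 1 - 4 * \<sigma>"
proof -
  let ?r = "sqrt (1 - 4 * \<sigma>)"
  have r: "?r * ?r = 1 - 4 * \<sigma>" using assms by simp
  have "(1 + ?r) / 2 * ((1 - ?r) / 2) = (1 - ?r * ?r) / 4" by (simp add: field_simps)
  then have "(1 + ?r) / 2 * ((1 - ?r) / 2) = \<sigma>" unfolding r by simp
  moreover have "((1 + ?r) / 2 - (1 - ?r) / 2)\<^sup>2 = ?r * ?r" by (simp add: field_simps power2_eq_square)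
  ultimately show ?thesis
    using that[of "(1 + ?r) / 2" "(1 - ?r) / 2"] r by (simp add: bidiag_def fun_eq_iff field_simps)
qed

lemma sum_tridiag_eq_bidiag:
  assumes "\<sigma> \<le> 1 / 4" and x: "x 0 = 0" "x M = 0" and y: "y 0 = 0" "y M = 0"
  shows "(\<Sum>i=1..M - 1. x i * (y i + \<sigma> * (y (i + 1) - 2 * y i + y (i - 1)))) =
    (\<Sum>i<M. bidiag \<sigma> x i * bidiag \<sigma> y i)"
proof -
  obtain p q where b: "bidiag \<sigma> = (\<lambda>x i. p * x i + q * x (i + 1))"
    and pq: "p + q = 1" "p * q = \<sigma>"
    using bidiag_eq[OF assms(1)] by blast
  have s: "p\<^sup>2 + q\<^sup>2 = 1 - 2 * \<sigma>"
    using arg_cong[OF pq(1), of "\<lambda>t. t\<^sup>2"] pq(2) by (simp add: power2_sum)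
  have "(\<Sum>i<M. bidiag \<sigma> x i * bidiag \<sigma> y i) =
      (\<Sum>i<M. p\<^sup>2 * (x i * y i) + \<sigma> * (x i * y (i + 1))) +
      (\<Sum>i<M. q\<^sup>2 * (x (Suc i) * y (Suc i)) + \<sigma> * (x (Suc i) * y (Suc i - 1)))"
    unfolding b sum.distrib[symmetric] unfolding pq(2)[symmetric]
    by (intro sum.cong refl) (simp add: algebra_simps power2_eq_square)
  also have "\<dots> =
      (\<Sum>i=1..M - 1. p\<^sup>2 * (x i * y i) + \<sigma> * (x i * y (i + 1))) +
      (\<Sum>i=1..M - 1. q\<^sup>2 * (x i * y i) + \<sigma> * (x i * y (i - 1)))"
    using sum_lessThan_interior[of "\<lambda>i. p\<^sup>2 * (x i * y i) + \<sigma> * (x i * y (i + 1))" M]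
      sum_shift_interior[of "\<lambda>i. q\<^sup>2 * (x i * y i) + \<sigma> * (x i * y (i - 1))" M] x
    by simp
  also have "\<dots> = (\<Sum>i=1..M - 1. (p\<^sup>2 + q\<^sup>2) * (x i * y i) + \<sigma> * (x i * (y (i + 1) + y (i - 1))))"
    unfolding sum.distrib[symmetric] by (intro sum.cong refl) (simp add: algebra_simps)
  also have "\<dots> = (\<Sum>i=1..M - 1. x i * (y i + \<sigma> * (y (i + 1) - 2 * y i + y (i - 1))))"
    unfolding s by (intro sum.cong refl) (simp add: algebra_simps)
  finally show ?thesis by simp
qed

lemma sum_bidiag_square_ge:
  assumes \<sigma>: "0 \<le> \<sigma>" "\<sigma> \<le> 1 / 4" and x: "x 0 = 0" "x M = 0"
  shows "(1 - 4 * \<sigma>) * (\<Sum>i=1..M - 1. (x i)\<^sup>2) \<le> (\<Sum>i<M. (bidiag \<sigma> x i)\<^sup>2)"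
proof -
  obtain p q where b: "bidiag \<sigma> = (\<lambda>x i. p * x i + q * x (i + 1))"
    and pq: "p * q = \<sigma>" "(p - q)\<^sup>2 = 1 - 4 * \<sigma>"
    using bidiag_eq[OF \<sigma>(2)] by metis
  have "1 - 4 * \<sigma> = (p\<^sup>2 - \<sigma>) + (q\<^sup>2 - \<sigma>)"
    using pq by (simp add: power2_diff)
  then have "(1 - 4 * \<sigma>) * (\<Sum>i=1..M - 1. (x i)\<^sup>2) =
      (p\<^sup>2 - \<sigma>) * (\<Sum>i=1..M - 1. (x i)\<^sup>2) + (q\<^sup>2 - \<sigma>) * (\<Sum>i=1..M - 1. (x i)\<^sup>2)"
    by (simp only: distrib_right)
  also have "\<dots> = (\<Sum>i<M. (p\<^sup>2 - \<sigma>) * (x i)\<^sup>2 + (q\<^sup>2 - \<sigma>) * (x (Suc i))\<^sup>2)"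
    using sum_lessThan_interior[of "\<lambda>i. (x i)\<^sup>2" M] sum_shift_interior[of "\<lambda>i. (x i)\<^sup>2" M] x
    by (simp add: sum.distrib flip: sum_distrib_left)
  also have "\<dots> \<le> (\<Sum>i<M. (bidiag \<sigma> x i)\<^sup>2)"
  proof (rule sum_mono)
    fix i
    have "0 \<le> \<sigma> * (x i + x (Suc i))\<^sup>2" using \<sigma> by simp
    then show "(p\<^sup>2 - \<sigma>) * (x i)\<^sup>2 + (q\<^sup>2 - \<sigma>) * (x (Suc i))\<^sup>2 \<le> (bidiag \<sigma> x i)\<^sup>2"
      unfolding b unfolding pq(1)[symmetric] by (simp add: algebra_simps power2_eq_square)
  qed
  finally show ?thesis .
qed

lemma sigma2_bounds:
  assumes "1 < \<gamma>" "\<gamma> < 2"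
  shows "0 < \<sigma>\<^sub>2 \<gamma>" "\<sigma>\<^sub>2 \<gamma> < 1 / 4"
proof -
  have "0 < (\<gamma> - 1) * (2 - \<gamma>)" using assms by simp
  then have "2 * \<gamma>\<^sup>2 - 6 * \<gamma> + 3 < 0" by (simp add: algebra_simps power2_eq_square)
  then show "0 < \<sigma>\<^sub>2 \<gamma>" unfolding \<sigma>\<^sub>2_def using assms by (intro divide_pos_pos) auto
  \<comment> \<open>The upper bound amounts to \<open>2 \<gamma>\<^sup>2 - 9 / 2 \<gamma> + 3 > 0\<close>; the minimum is attained at \<open>9 / 8\<close>.\<close>
  have "0 \<le> 2 * (\<gamma> - 9 / 8)\<^sup>2" by simp
  then have "- (2 * \<gamma>\<^sup>2 - 6 * \<gamma> + 3) < 1 / 4 * (6 * \<gamma>)"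
    by (simp add: algebra_simps power2_eq_square)
  then show "\<sigma>\<^sub>2 \<gamma> < 1 / 4" unfolding \<sigma>\<^sub>2_def using assms by (subst pos_divide_less_eq) auto
qed


section \<open>Quadratic forms of the two-dimensional operators\<close>

text \<open>
  Grid functions with zero boundary values, extended by zero to all indices beyond the grid.
\<close>

definition vanishes_outside :: "nat \<Rightarrow> nat \<Rightarrow> grid_fun \<Rightarrow> bool" where
  "vanishes_outside Ma Mb w \<longleftrightarrow> (\<forall>i j. i = 0 \<or> Ma \<le> i \<or> j = 0 \<or> Mb \<le> j \<longrightarrow> w i j = 0)"

text \<open>
  The inner product over the interior grid points, without the factor \<open>ha * hb\<close>.
\<close>

definition pairing :: "nat \<Rightarrow> nat \<Rightarrow> grid_fun \<Rightarrow> grid_fun \<Rightarrow> real" where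
  "pairing Ma Mb v w = (\<Sum>i=1..Ma - 1. \<Sum>j=1..Mb - 1. v i j * w i j)"

text \<open>
  The bidiagonal factors of \<open>Lx\<close> and \<open>Ly\<close>.
\<close>

definition Gx :: "real \<Rightarrow> grid_fun \<Rightarrow> grid_fun" where
  "Gx \<alpha> w i j = bidiag (\<sigma>\<^sub>2 \<alpha>) (\<lambda>i. w i j) i"

definition Gy :: "real \<Rightarrow> grid_fun \<Rightarrow> grid_fun" where
  "Gy \<beta> w i j = bidiag (\<sigma>\<^sub>2 \<beta>) (w i) j"

lemma pairing_transpose: "pairing Ma Mb v w = pairing Mb Ma (\<lambda>j i. v i j) (\<lambda>j i. w i j)"
  unfolding pairing_def by (rule sum.swap)

lemma vanishes_outside_transpose:
  "vanishes_outside Ma Mb w \<Longrightarrow> vanishes_outside Mb Ma (\<lambda>j i. w i j)"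
  by (auto simp: vanishes_outside_def)

lemma pairing_Lx:
  assumes \<alpha>: "1 < \<alpha>" "\<alpha> < 2"
    and "\<And>j. v 0 j = 0" "\<And>j. v Ma j = 0" "\<And>j. w 0 j = 0" "\<And>j. w Ma j = 0"
  shows "pairing Ma Mb v (Lx \<alpha> w) = (\<Sum>i<Ma. \<Sum>j=1..Mb - 1. Gx \<alpha> v i j * Gx \<alpha> w i j)"
proof -
  have "pairing Ma Mb v (Lx \<alpha> w) = (\<Sum>j=1..Mb - 1. \<Sum>i=1..Ma - 1. v i j * Lx \<alpha> w i j)"
    unfolding pairing_def by (rule sum.swap)
  also have "\<dots> = (\<Sum>j=1..Mb - 1. \<Sum>i<Ma. Gx \<alpha> v i j * Gx \<alpha> w i j)"
    unfolding Lx_def Gx_def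
    using assms sigma2_bounds[OF \<alpha>] by (intro sum.cong refl sum_tridiag_eq_bidiag) auto
  also have "\<dots> = (\<Sum>i<Ma. \<Sum>j=1..Mb - 1. Gx \<alpha> v i j * Gx \<alpha> w i j)"
    by (rule sum.swap)
  finally show ?thesis .
qed

lemma pairing_Ly:
  assumes \<beta>: "1 < \<beta>" "\<beta> < 2"
    and "\<And>i. v i 0 = 0" "\<And>i. v i Mb = 0" "\<And>i. w i 0 = 0" "\<And>i. w i Mb = 0"
  shows "(\<Sum>i\<in>I. \<Sum>j=1..Mb - 1. v i j * Ly \<beta> w i j) = (\<Sum>i\<in>I. \<Sum>j<Mb. Gy \<beta> v i j * Gy \<beta> w i j)"
  unfolding Ly_def Gy_def
  using assms sigma2_bounds[OF \<beta>] by (intro sum.cong refl sum_tridiag_eq_bidiag) auto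

lemma Gx_Ly: "Gx \<alpha> (Ly \<beta> w) = Ly \<beta> (Gx \<alpha> w)"
  by (simp add: fun_eq_iff Gx_def Ly_def bidiag_def) (simp add: algebra_simps add_divide_distrib diff_divide_distrib)

lemma pairing_Lx_Ly:
  assumes \<alpha>: "1 < \<alpha>" "\<alpha> < 2" and \<beta>: "1 < \<beta>" "\<beta> < 2"
    and v: "vanishes_outside Ma Mb v" and w: "vanishes_outside Ma Mb w"
  shows "pairing Ma Mb v (Lx \<alpha> (Ly \<beta> w)) =
    (\<Sum>i<Ma. \<Sum>j<Mb. Gy \<beta> (Gx \<alpha> v) i j * Gy \<beta> (Gx \<alpha> w) i j)"
proof -
  have "pairing Ma Mb v (Lx \<alpha> (Ly \<beta> w)) =
      (\<Sum>i<Ma. \<Sum>j=1..Mb - 1. Gx \<alpha> v i j * Ly \<beta> (Gx \<alpha> w) i j)"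
    unfolding Gx_Ly[symmetric] using v w
    by (intro pairing_Lx \<alpha>) (auto simp: vanishes_outside_def Ly_def)
  also have "\<dots> = (\<Sum>i<Ma. \<Sum>j<Mb. Gy \<beta> (Gx \<alpha> v) i j * Gy \<beta> (Gx \<alpha> w) i j)"
    using v w by (intro pairing_Ly \<beta>) (auto simp: vanishes_outside_def Gx_def bidiag_def)
  finally show ?thesis .
qed

lemma sum_Gy_Gx_square_ge:
  assumes \<alpha>: "1 < \<alpha>" "\<alpha> < 2" and \<beta>: "1 < \<beta>" "\<beta> < 2"
    and w: "vanishes_outside Ma Mb w"
  shows "(1 - 4 * \<sigma>\<^sub>2 \<alpha>) * (1 - 4 * \<sigma>\<^sub>2 \<beta>) * pairing Ma Mb w w \<le>
    (\<Sum>i<Ma. \<Sum>j<Mb. (Gy \<beta> (Gx \<alpha> w) i j)\<^sup>2)"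
proof -
  note \<sigma> = sigma2_bounds[OF \<alpha>] sigma2_bounds[OF \<beta>]
  have "(1 - 4 * \<sigma>\<^sub>2 \<alpha>) * pairing Ma Mb w w =
      (\<Sum>j=1..Mb - 1. (1 - 4 * \<sigma>\<^sub>2 \<alpha>) * (\<Sum>i=1..Ma - 1. (w i j)\<^sup>2))"
    unfolding pairing_def sum_distrib_left by (subst sum.swap) (simp add: power2_eq_square)
  also have "\<dots> \<le> (\<Sum>j=1..Mb - 1. \<Sum>i<Ma. (Gx \<alpha> w i j)\<^sup>2)"
    unfolding Gx_def using \<sigma> w
    by (intro sum_mono sum_bidiag_square_ge) (auto simp: vanishes_outside_def)
  finally have "(1 - 4 * \<sigma>\<^sub>2 \<beta>) * ((1 - 4 * \<sigma>\<^sub>2 \<alpha>) * pairing Ma Mb w w) \<le>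
      (1 - 4 * \<sigma>\<^sub>2 \<beta>) * (\<Sum>j=1..Mb - 1. \<Sum>i<Ma. (Gx \<alpha> w i j)\<^sup>2)"
    using \<sigma> by (intro mult_left_mono) auto
  also have "\<dots> = (\<Sum>i<Ma. (1 - 4 * \<sigma>\<^sub>2 \<beta>) * (\<Sum>j=1..Mb - 1. (Gx \<alpha> w i j)\<^sup>2))"
    unfolding sum_distrib_left by (rule sum.swap)
  also have "\<dots> \<le> (\<Sum>i<Ma. \<Sum>j<Mb. (Gy \<beta> (Gx \<alpha> w) i j)\<^sup>2)"
    unfolding Gy_def using \<sigma> w
    by (intro sum_mono sum_bidiag_square_ge) (auto simp: vanishes_outside_def Gx_def bidiag_def)
  finally show ?thesis by (simp add: mult_ac)
qed

lemma \<delta>x_Gy: "\<delta>x \<alpha> h M (Gy \<beta> w) = Gy \<beta> (\<delta>x \<alpha> h M w)"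
proof (intro ext)
  fix i j
  have lin: "(\<Sum>l\<in>A. \<kappa>\<^sub>2 \<alpha> l * (p * F l + q * H l)) =
      p * (\<Sum>l\<in>A. \<kappa>\<^sub>2 \<alpha> l * F l) + q * (\<Sum>l\<in>A. \<kappa>\<^sub>2 \<alpha> l * H l)" for A :: "nat set" and F H and p q :: real
    by (simp add: sum_distrib_left sum.distrib[symmetric] algebra_simps)
  show "\<delta>x \<alpha> h M (Gy \<beta> w) i j = Gy \<beta> (\<delta>x \<alpha> h M w) i j"
    unfolding \<delta>x_def Gy_def bidiag_def lin by (simp only: algebra_simps)
qed

text \<open>
  Factoring \<open>Ly\<close> and commuting its factor with \<open>\<delta>x\<close> reduces the form to a sum over \<open>j\<close> of
  one-dimensional forms. Since \<open>cos (pi * \<alpha> / 2) < 0\<close>, the prefactor of \<open>\<delta>x\<close> is positive.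
\<close>

lemma pairing_Ly_\<delta>x_nonpos:
  assumes \<alpha>: "1 < \<alpha>" "\<alpha> < 2" and \<beta>: "1 < \<beta>" "\<beta> < 2" and "h > 0"
    and w: "vanishes_outside Ma Mb w"
  shows "pairing Ma Mb w (Ly \<beta> (\<delta>x \<alpha> h Ma w)) \<le> 0"
proof -
  have "cos (pi * \<alpha> / 2) < 0"
  proof -
    have "1 * pi < \<alpha> * pi" "\<alpha> * pi < 2 * pi"
      using \<alpha> by (intro mult_strict_right_mono; simp)+
    then have "cos (pi * \<alpha> / 2) < cos (pi / 2)"
      by (intro cos_monotone_0_pi) (auto simp: mult.commute)
    then show ?thesis by simp
  qed
  then have pre: "0 \<le> - 1 / (2 * cos (pi * \<alpha> / 2) * h powr \<alpha>)"
    using \<open>h > 0\<close> by (simp add: divide_nonpos_neg mult_neg_pos less_imp_le)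
  have "pairing Ma Mb w (Ly \<beta> (\<delta>x \<alpha> h Ma w)) =
      (\<Sum>i=1..Ma - 1. \<Sum>j<Mb. Gy \<beta> w i j * \<delta>x \<alpha> h Ma (Gy \<beta> w) i j)"
    unfolding pairing_def \<delta>x_Gy using w
    by (intro pairing_Ly \<beta>) (auto simp: vanishes_outside_def \<delta>x_def)
  also have "\<dots> = (\<Sum>j<Mb. \<Sum>i=1..Ma - 1. Gy \<beta> w i j * \<delta>x \<alpha> h Ma (Gy \<beta> w) i j)"
    by (rule sum.swap)
  also have "\<dots> \<le> 0"
  proof (rule sum_nonpos)
    fix j
    let ?x = "\<lambda>i. Gy \<beta> w i j"
    have "(\<Sum>i=1..Ma - 1. ?x i * \<delta>x \<alpha> h Ma (Gy \<beta> w) i j) =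
        - 1 / (2 * cos (pi * \<alpha> / 2) * h powr \<alpha>) *
        (\<Sum>i=1..Ma - 1. ?x i * ((\<Sum>l=0..i + 1. \<kappa>\<^sub>2 \<alpha> l * ?x (i + 1 - l)) +
          (\<Sum>l=0..Ma - i + 1. \<kappa>\<^sub>2 \<alpha> l * ?x (i + l - 1))))"
      unfolding sum_distrib_left[of "- 1 / (2 * cos (pi * \<alpha> / 2) * h powr \<alpha>)"] \<delta>x_def
      by (intro sum.cong refl) (rule mult.left_commute)
    also have "\<dots> \<le> 0"
      using w by (intro mult_nonneg_nonpos pre kappa_two_sided_form_nonpos \<alpha>)
        (auto simp: vanishes_outside_def Gy_def bidiag_def)
    finally show "(\<Sum>i=1..Ma - 1. ?x i * \<delta>x \<alpha> h Ma (Gy \<beta> w) i j) \<le> 0" .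
  qed
  finally show ?thesis .
qed

lemma pairing_Lx_\<delta>y_nonpos:
  assumes \<alpha>: "1 < \<alpha>" "\<alpha> < 2" and \<beta>: "1 < \<beta>" "\<beta> < 2" and "h > 0"
    and w: "vanishes_outside Ma Mb w"
  shows "pairing Ma Mb w (Lx \<alpha> (\<delta>y \<beta> h Mb w)) \<le> 0"
proof -
  have "(\<lambda>j i. Lx \<alpha> (\<delta>y \<beta> h Mb w) i j) = Ly \<alpha> (\<delta>x \<beta> h Mb (\<lambda>j i. w i j))"
    by (simp add: fun_eq_iff Lx_def Ly_def \<delta>x_def \<delta>y_def)
  then show ?thesis
    using pairing_Ly_\<delta>x_nonpos[OF \<beta> \<alpha> \<open>h > 0\<close> vanishes_outside_transpose[OF w]]
    by (subst pairing_transpose) simp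
qed


section \<open>The discrete energy estimate\<close>

text \<open>
  One time step of the energy estimate: \<open>e0\<close> and \<open>e1\<close> are the errors at consecutive levels, \<open>d\<close> is
  their difference quotient and \<open>w\<close> their mean.
\<close>

lemma energy_step:
  fixes e0 e1 R :: grid_fun
  assumes \<alpha>: "1 < \<alpha>" "\<alpha> < 2" and \<beta>: "1 < \<beta>" "\<beta> < 2"
    and pos: "K\<^sub>\<alpha> > 0" "K\<^sub>\<beta> > 0" "ha > 0" "hb > 0" "\<tau> > 0"
    and van: "vanishes_outside Ma Mb e0" "vanishes_outside Ma Mb e1"
  defines "d \<equiv> \<lambda>i j. (e1 i j - e0 i j) / \<tau>" and "w \<equiv> \<lambda>i j. (e1 i j + e0 i j) / 2"
    and "c \<equiv> (1 - 4 * \<sigma>\<^sub>2 \<alpha>) * (1 - 4 * \<sigma>\<^sub>2 \<beta>)"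
  assumes eq: "\<And>i j. i \<in> {1..Ma - 1} \<Longrightarrow> j \<in> {1..Mb - 1} \<Longrightarrow>
      Lx \<alpha> (Ly \<beta> d) i j = - Lx \<alpha> (Ly \<beta> w) i j + K\<^sub>\<alpha> * Ly \<beta> (\<delta>x \<alpha> ha Ma w) i j
        + K\<^sub>\<beta> * Lx \<alpha> (\<delta>y \<beta> hb Mb w) i j - R i j"
  shows "(\<Sum>i<Ma. \<Sum>j<Mb. (Gy \<beta> (Gx \<alpha> e1) i j)\<^sup>2) \<le>
    (\<Sum>i<Ma. \<Sum>j<Mb. (Gy \<beta> (Gx \<alpha> e0) i j)\<^sup>2) + \<tau> / (2 * c) * pairing Ma Mb R R"
proof -
  define E where "E = (\<lambda>v. \<Sum>i<Ma. \<Sum>j<Mb. (Gy \<beta> (Gx \<alpha> v) i j)\<^sup>2)"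
  have c: "c > 0" using sigma2_bounds[OF \<alpha>] sigma2_bounds[OF \<beta>] by (simp add: c_def)
  have van_w: "vanishes_outside Ma Mb w" and van_d: "vanishes_outside Ma Mb d"
    using van by (auto simp: vanishes_outside_def w_def d_def)
  have "pairing Ma Mb w (Lx \<alpha> (Ly \<beta> d)) = (\<Sum>i<Ma. \<Sum>j<Mb. Gy \<beta> (Gx \<alpha> w) i j * Gy \<beta> (Gx \<alpha> d) i j)"
    by (rule pairing_Lx_Ly[OF \<alpha> \<beta> van_w van_d])
  also have "\<dots> = (\<Sum>i<Ma. \<Sum>j<Mb.
      ((Gy \<beta> (Gx \<alpha> e1) i j)\<^sup>2 - (Gy \<beta> (Gx \<alpha> e0) i j)\<^sup>2) * (1 / (2 * \<tau>)))"
  proof (intro sum.cong refl)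
    fix i j
    have Gw: "Gy \<beta> (Gx \<alpha> w) i j = (Gy \<beta> (Gx \<alpha> e1) i j + Gy \<beta> (Gx \<alpha> e0) i j) / 2"
      by (simp add: w_def Gx_def Gy_def bidiag_def) (simp add: field_simps)
    have Gd: "Gy \<beta> (Gx \<alpha> d) i j = (Gy \<beta> (Gx \<alpha> e1) i j - Gy \<beta> (Gx \<alpha> e0) i j) / \<tau>"
      using pos by (simp add: d_def Gx_def Gy_def bidiag_def) (simp add: field_simps)
    show "Gy \<beta> (Gx \<alpha> w) i j * Gy \<beta> (Gx \<alpha> d) i j =
        ((Gy \<beta> (Gx \<alpha> e1) i j)\<^sup>2 - (Gy \<beta> (Gx \<alpha> e0) i j)\<^sup>2) * (1 / (2 * \<tau>))"
      unfolding Gw Gd by (simp add: power2_eq_square square_diff_square_factored)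
  qed
  also have "\<dots> = (E e1 - E e0) / (2 * \<tau>)"
    by (simp only: E_def sum_subtractf flip: sum_distrib_right) simp
  finally have lhs: "pairing Ma Mb w (Lx \<alpha> (Ly \<beta> d)) = (E e1 - E e0) / (2 * \<tau>)" .
  have "pairing Ma Mb w (Lx \<alpha> (Ly \<beta> d)) =
      (\<Sum>i=1..Ma - 1. \<Sum>j=1..Mb - 1. - (w i j * Lx \<alpha> (Ly \<beta> w) i j)
        + K\<^sub>\<alpha> * (w i j * Ly \<beta> (\<delta>x \<alpha> ha Ma w) i j)
        + K\<^sub>\<beta> * (w i j * Lx \<alpha> (\<delta>y \<beta> hb Mb w) i j) - w i j * R i j)"
    unfolding pairing_def
    by (intro sum.cong refl) (simp only: eq distrib_left right_diff_distrib mult_minus_right mult.left_commute)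
  also have "\<dots> = - pairing Ma Mb w (Lx \<alpha> (Ly \<beta> w)) + K\<^sub>\<alpha> * pairing Ma Mb w (Ly \<beta> (\<delta>x \<alpha> ha Ma w))
      + K\<^sub>\<beta> * pairing Ma Mb w (Lx \<alpha> (\<delta>y \<beta> hb Mb w)) - pairing Ma Mb w R"
    by (simp only: pairing_def sum.distrib sum_subtractf sum_negf flip: sum_distrib_left)
  also have "\<dots> \<le> - (c * pairing Ma Mb w w) - pairing Ma Mb w R"
  proof -
    have "c * pairing Ma Mb w w \<le> pairing Ma Mb w (Lx \<alpha> (Ly \<beta> w))"
      using sum_Gy_Gx_square_ge[OF \<alpha> \<beta> van_w] pairing_Lx_Ly[OF \<alpha> \<beta> van_w van_w]
      by (simp add: c_def power2_eq_square)
    moreover have "K\<^sub>\<alpha> * pairing Ma Mb w (Ly \<beta> (\<delta>x \<alpha> ha Ma w)) \<le> 0"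
      using pos by (intro mult_nonneg_nonpos pairing_Ly_\<delta>x_nonpos \<alpha> \<beta> van_w) auto
    moreover have "K\<^sub>\<beta> * pairing Ma Mb w (Lx \<alpha> (\<delta>y \<beta> hb Mb w)) \<le> 0"
      using pos by (intro mult_nonneg_nonpos pairing_Lx_\<delta>y_nonpos \<alpha> \<beta> van_w) auto
    ultimately show ?thesis by linarith
  qed
  also have "\<dots> \<le> pairing Ma Mb R R / (4 * c)"
  proof -
    have "- (c * pairing Ma Mb w w) - pairing Ma Mb w R =
        (\<Sum>i=1..Ma - 1. \<Sum>j=1..Mb - 1. - (c * (w i j * w i j)) - w i j * R i j)"
      by (simp only: pairing_def sum_subtractf sum_negf sum_distrib_left)
    also have "\<dots> \<le> (\<Sum>i=1..Ma - 1. \<Sum>j=1..Mb - 1. R i j * R i j / (4 * c))"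
    proof (intro sum_mono)
      fix i j
      \<comment> \<open>Young's inequality, weighted so that the damping term is used up exactly.\<close>
      have "0 \<le> (2 * c * w i j + R i j)\<^sup>2 / (4 * c)" using c by simp
      also have "\<dots> = R i j * R i j / (4 * c) - (- (c * (w i j * w i j)) - w i j * R i j)"
        using c by (simp add: power2_eq_square field_simps)
      finally show "- (c * (w i j * w i j)) - w i j * R i j \<le> R i j * R i j / (4 * c)" by simp
    qed
    also have "\<dots> = pairing Ma Mb R R / (4 * c)"
      by (simp only: pairing_def sum_divide_distrib)
    finally show ?thesis .
  qed
  finally have "(E e1 - E e0) / (2 * \<tau>) \<le> pairing Ma Mb R R / (4 * c)" unfolding lhs .
  then have "(E e1 - E e0) / (2 * \<tau>) * (2 * \<tau>) \<le> pairing Ma Mb R R / (4 * c) * (2 * \<tau>)"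
    using pos by (intro mult_right_mono) auto
  then have "E e1 - E e0 \<le> \<tau> / (2 * c) * pairing Ma Mb R R"
    using pos by simp
  then show ?thesis by (simp add: E_def)
qed


section \<open>Convergence of the scheme\<close>

lemma closure_Omega:
  assumes "La > 0" "Lb > 0"
  shows "closure (Omega La Lb) = {0..La} \<times> {0..Lb}"
  using assms by (simp add: Omega_def closure_Times)

lemma frontier_Omega:
  assumes "La > 0" "Lb > 0"
  shows "frontier (Omega La Lb) = {0..La} \<times> {0..Lb} - {0<..<La} \<times> {0<..<Lb}"
proof -
  have "interior (Omega La Lb) = Omega La Lb"
    by (intro interior_open) (simp add: Omega_def open_Times)
  then show ?thesis using closure_Omega[OF assms] by (simp add: frontier_def Omega_def)
qed

lemma grid_point_bounds:
  assumes "L > 0" "M > 0" "i \<le> M"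
  shows "real i * step L M \<in> {0..L}"
proof -
  have "real i * (L / real M) \<le> real M * (L / real M)"
    using assms by (intro mult_right_mono) auto
  then show ?thesis using assms by (simp add: step_def)
qed

lemma grid_boundary_in_frontier:
  assumes "La > 0" "Lb > 0" "Ma > 0" "Mb > 0" "i \<le> Ma" "j \<le> Mb"
    and "i = 0 \<or> i = Ma \<or> j = 0 \<or> j = Mb"
  shows "(real i * step La Ma, real j * step Lb Mb) \<in> frontier (Omega La Lb)"
  using grid_point_bounds[OF assms(1,3,5)] grid_point_bounds[OF assms(2,4,6)] assms
  by (auto simp: frontier_Omega step_def)

lemma scheme_error_vanishes_initially_and_on_boundary:
  assumes L: "La > 0" "Lb > 0" "T > 0"
    and pde: "is_pde_solution \<alpha> \<beta> K\<^sub>\<alpha> K\<^sub>\<beta> La Lb T f u0 u"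
    and M: "Ma > 0" "Mb > 0" "N > 0"
    and scheme: "is_scheme_solution \<alpha> \<beta> K\<^sub>\<alpha> K\<^sub>\<beta> La Lb T f u0 Ma Mb N v"
    and ij: "i \<le> Ma" "j \<le> Mb" and k: "k \<le> N"
    and bd: "k = 0 \<or> i = 0 \<or> i = Ma \<or> j = 0 \<or> j = Mb"
  shows "v k i j = sample La Lb T Ma Mb N u k i j"
proof (cases "k = 0")
  case True
  have "(real i * step La Ma, real j * step Lb Mb) \<in> closure (Omega La Lb)"
    using grid_point_bounds[of La Ma i] grid_point_bounds[of Lb Mb j] L M ij
    by (simp add: closure_Omega)
  then have "u (real i * step La Ma) (real j * step Lb Mb) 0 = u0 (real i * step La Ma) (real j * step Lb Mb)"
    using pde unfolding is_pde_solution_def by fast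
  moreover have "v 0 i j = u0 (real i * step La Ma) (real j * step Lb Mb)"
    using scheme ij unfolding is_scheme_solution_def by simp
  ultimately show ?thesis using True by (simp add: sample_def)
next
  case False
  have fr: "(real i * step La Ma, real j * step Lb Mb) \<in> frontier (Omega La Lb)"
    using grid_boundary_in_frontier[of La Lb Ma Mb i j] L M ij bd False by auto
  have "real k * step T N \<in> {0<..T}"
    using grid_point_bounds[of T N k] L M k False by (simp add: step_def)
  then have "u (real i * step La Ma) (real j * step Lb Mb) (real k * step T N) = 0"
    using pde fr unfolding is_pde_solution_def by fast
  moreover have "v k i j = 0"
    using scheme fr ij k False unfolding is_scheme_solution_def by simp
  ultimately show ?thesis by (simp add: sample_def)
qed

text \<open>
  The difference operators are linear, and at interior points they read only values on the closed
  grid; agreement of \<open>e\<close> with \<open>v - w\<close> there is enough.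
\<close>

lemma Ly_\<delta>x_diff:
  assumes e: "\<And>i j. i \<le> Ma \<Longrightarrow> j \<le> Mb \<Longrightarrow> e i j = v i j - w i j"
    and ij: "1 \<le> i" "i < Ma" "1 \<le> j" "j < Mb"
  shows "Ly \<beta> (\<delta>x \<alpha> h Ma e) i j = Ly \<beta> (\<delta>x \<alpha> h Ma v) i j - Ly \<beta> (\<delta>x \<alpha> h Ma w) i j"
proof -
  have "\<delta>x \<alpha> h Ma e i m = \<delta>x \<alpha> h Ma v i m - \<delta>x \<alpha> h Ma w i m" if "m \<le> Mb" for m
  proof -
    have "(\<Sum>l=0..i + 1. \<kappa>\<^sub>2 \<alpha> l * e (i + 1 - l) m) =
        (\<Sum>l=0..i + 1. \<kappa>\<^sub>2 \<alpha> l * v (i + 1 - l) m) - (\<Sum>l=0..i + 1. \<kappa>\<^sub>2 \<alpha> l * w (i + 1 - l) m)"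
      unfolding sum_subtractf[symmetric] right_diff_distrib[symmetric]
      using ij that by (intro sum.cong refl arg_cong2[where f = "(*)"] e) auto
    moreover have "(\<Sum>l=0..Ma - i + 1. \<kappa>\<^sub>2 \<alpha> l * e (i + l - 1) m) =
        (\<Sum>l=0..Ma - i + 1. \<kappa>\<^sub>2 \<alpha> l * v (i + l - 1) m) -
        (\<Sum>l=0..Ma - i + 1. \<kappa>\<^sub>2 \<alpha> l * w (i + l - 1) m)"
      unfolding sum_subtractf[symmetric] right_diff_distrib[symmetric]
      using ij that by (intro sum.cong refl arg_cong2[where f = "(*)"] e) auto
    ultimately show ?thesis unfolding \<delta>x_def
      by (simp only: right_diff_distrib[symmetric] add_diff_add)
  qed
  then show ?thesis using ij by (simp add: Ly_def) (simp add: algebra_simps)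
qed

lemma Lx_\<delta>y_diff:
  assumes e: "\<And>i j. i \<le> Ma \<Longrightarrow> j \<le> Mb \<Longrightarrow> e i j = v i j - w i j"
    and ij: "1 \<le> i" "i < Ma" "1 \<le> j" "j < Mb"
  shows "Lx \<alpha> (\<delta>y \<beta> h Mb e) i j = Lx \<alpha> (\<delta>y \<beta> h Mb v) i j - Lx \<alpha> (\<delta>y \<beta> h Mb w) i j"
proof -
  have transpose: "Lx \<alpha> (\<delta>y \<beta> h Mb z) i j = Ly \<alpha> (\<delta>x \<beta> h Mb (\<lambda>j i. z i j)) j i" for z
    by (simp add: Lx_def Ly_def \<delta>x_def \<delta>y_def)
  show ?thesis
    unfolding transpose using e ij by (intro Ly_\<delta>x_diff[where Mb = Ma]) auto
qed

lemma Lx_Ly_diff: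
  assumes e: "\<And>i j. i \<le> Ma \<Longrightarrow> j \<le> Mb \<Longrightarrow> e i j = v i j - w i j"
    and ij: "1 \<le> i" "i < Ma" "1 \<le> j" "j < Mb"
  shows "Lx \<alpha> (Ly \<beta> e) i j = Lx \<alpha> (Ly \<beta> v) i j - Lx \<alpha> (Ly \<beta> w) i j"
proof -
  have "Ly \<beta> e m j = Ly \<beta> v m j - Ly \<beta> w m j" if "m \<le> Ma" for m
    using ij that by (simp add: Ly_def e algebra_simps)
  then show ?thesis using ij by (simp add: Lx_def) (simp add: algebra_simps)
qed

text \<open>
  The convergence estimate for one grid, with an arbitrary bound \<open>B\<close> on the truncation error.
\<close>

lemma scheme_error_bound:
  assumes \<alpha>: "1 < \<alpha>" "\<alpha> < 2" and \<beta>: "1 < \<beta>" "\<beta> < 2"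
    and K: "K\<^sub>\<alpha> > 0" "K\<^sub>\<beta> > 0" and L: "La > 0" "Lb > 0" "T > 0"
    and pde: "is_pde_solution \<alpha> \<beta> K\<^sub>\<alpha> K\<^sub>\<beta> La Lb T f u0 u"
    and M: "Ma > 0" "Mb > 0" "N > 0"
    and scheme: "is_scheme_solution \<alpha> \<beta> K\<^sub>\<alpha> K\<^sub>\<beta> La Lb T f u0 Ma Mb N v"
    and trunc: "\<And>i j k. i \<in> {1..Ma - 1} \<Longrightarrow> j \<in> {1..Mb - 1} \<Longrightarrow> k \<in> {0..N - 1} \<Longrightarrow>
      \<bar>truncation_error \<alpha> \<beta> K\<^sub>\<alpha> K\<^sub>\<beta> La Lb T f u Ma Mb N k i j\<bar> \<le> B"
    and k: "k \<le> N"
  shows "grid_norm (step La Ma) (step Lb Mb) Ma Mb (\<lambda>i j. v k i j - sample La Lb T Ma Mb N u k i j)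
    \<le> \<bar>B\<bar> / ((1 - 4 * \<sigma>\<^sub>2 \<alpha>) * (1 - 4 * \<sigma>\<^sub>2 \<beta>)) * sqrt (T * La * Lb)"
proof -
  define \<tau> ha hb where "\<tau> = step T N" and "ha = step La Ma" and "hb = step Lb Mb"
  have h: "\<tau> > 0" "ha > 0" "hb > 0" using L M by (auto simp: \<tau>_def ha_def hb_def step_def)
  define U where "U = sample La Lb T Ma Mb N u"
  define R where "R = truncation_error \<alpha> \<beta> K\<^sub>\<alpha> K\<^sub>\<beta> La Lb T f u Ma Mb N"
  define c where "c = (1 - 4 * \<sigma>\<^sub>2 \<alpha>) * (1 - 4 * \<sigma>\<^sub>2 \<beta>)"
  have c: "c > 0" using sigma2_bounds[OF \<alpha>] sigma2_bounds[OF \<beta>] by (simp add: c_def)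
  \<comment> \<open>The scheme does not determine \<open>v\<close> outside the closed grid, hence the extension by zero.\<close>
  define e where "e = (\<lambda>k i j. if 1 \<le> i \<and> i < Ma \<and> 1 \<le> j \<and> j < Mb then v k i j - U k i j else 0)"
  have e: "e k i j = v k i j - U k i j" if "i \<le> Ma" "j \<le> Mb" "k \<le> N" for i j k
    using scheme_error_vanishes_initially_and_on_boundary[OF L pde M scheme that] that
    by (auto simp: e_def U_def)
  have e_0: "e 0 i j = 0" for i j
    using scheme_error_vanishes_initially_and_on_boundary[OF L pde M scheme, of i j 0]
    by (auto simp: e_def U_def)
  have van: "vanishes_outside Ma Mb (e k)" for k
    by (auto simp: e_def vanishes_outside_def)
  define E where "E = (\<lambda>k. \<Sum>i<Ma. \<Sum>j<Mb. (Gy \<beta> (Gx \<alpha> (e k)) i j)\<^sup>2)"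
  have E_step: "E (Suc k) \<le> E k + \<tau> / (2 * c) * (real Ma * real Mb * B\<^sup>2)" if "k < N" for k
  proof -
    have "E (Suc k) \<le> E k + \<tau> / (2 * c) * pairing Ma Mb (R k) (R k)"
      unfolding E_def c_def
    proof (rule energy_step[OF \<alpha> \<beta> K h(2,3,1) van van])
      fix i j assume "i \<in> {1..Ma - 1}" "j \<in> {1..Mb - 1}"
      then have ij: "1 \<le> i" "i < Ma" "1 \<le> j" "j < Mb" by auto
      have v: "Lx \<alpha> (Ly \<beta> (\<delta>t \<tau> v k)) i j = - Lx \<alpha> (Ly \<beta> (midlevel v k)) i j
          + K\<^sub>\<alpha> * Ly \<beta> (\<delta>x \<alpha> ha Ma (midlevel v k)) i j
          + K\<^sub>\<beta> * Lx \<alpha> (\<delta>y \<beta> hb Mb (midlevel v k)) i j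
          + Lx \<alpha> (Ly \<beta> (sample_mid La Lb T Ma Mb N f k)) i j"
        using scheme ij \<open>k < N\<close> unfolding is_scheme_solution_def \<tau>_def ha_def hb_def by simp
      have U: "R k i j = Lx \<alpha> (Ly \<beta> (\<delta>t \<tau> U k)) i j + Lx \<alpha> (Ly \<beta> (midlevel U k)) i j
          - K\<^sub>\<alpha> * Ly \<beta> (\<delta>x \<alpha> ha Ma (midlevel U k)) i j
          - K\<^sub>\<beta> * Lx \<alpha> (\<delta>y \<beta> hb Mb (midlevel U k)) i j
          - Lx \<alpha> (Ly \<beta> (sample_mid La Lb T Ma Mb N f k)) i j"
        by (simp add: R_def truncation_error_def Let_def U_def \<tau>_def ha_def hb_def)
      let ?d = "\<lambda>i j. (e (Suc k) i j - e k i j) / \<tau>" and ?w = "\<lambda>i j. (e (Suc k) i j + e k i j) / 2"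
      have d: "?d i j = \<delta>t \<tau> v k i j - \<delta>t \<tau> U k i j" if "i \<le> Ma" "j \<le> Mb" for i j
        using that \<open>k < N\<close> e[of i j k] e[of i j "Suc k"] by (simp add: \<delta>t_def diff_divide_distrib)
      have w: "?w i j = midlevel v k i j - midlevel U k i j" if "i \<le> Ma" "j \<le> Mb" for i j
        using that \<open>k < N\<close> e[of i j k] e[of i j "Suc k"] by (simp add: midlevel_def field_simps)
      have ops:
        "Lx \<alpha> (Ly \<beta> ?d) i j = Lx \<alpha> (Ly \<beta> (\<delta>t \<tau> v k)) i j - Lx \<alpha> (Ly \<beta> (\<delta>t \<tau> U k)) i j"
        "Lx \<alpha> (Ly \<beta> ?w) i j = Lx \<alpha> (Ly \<beta> (midlevel v k)) i j - Lx \<alpha> (Ly \<beta> (midlevel U k)) i j"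
        "Ly \<beta> (\<delta>x \<alpha> ha Ma ?w) i j =
          Ly \<beta> (\<delta>x \<alpha> ha Ma (midlevel v k)) i j - Ly \<beta> (\<delta>x \<alpha> ha Ma (midlevel U k)) i j"
        "Lx \<alpha> (\<delta>y \<beta> hb Mb ?w) i j =
          Lx \<alpha> (\<delta>y \<beta> hb Mb (midlevel v k)) i j - Lx \<alpha> (\<delta>y \<beta> hb Mb (midlevel U k)) i j"
        by (rule Lx_Ly_diff[OF d] Lx_Ly_diff[OF w] Ly_\<delta>x_diff[OF w] Lx_\<delta>y_diff[OF w];
            (assumption | rule ij)+)+
      show "Lx \<alpha> (Ly \<beta> ?d) i j = - Lx \<alpha> (Ly \<beta> ?w) i j + K\<^sub>\<alpha> * Ly \<beta> (\<delta>x \<alpha> ha Ma ?w) i j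
          + K\<^sub>\<beta> * Lx \<alpha> (\<delta>y \<beta> hb Mb ?w) i j - R k i j"
        unfolding ops v U by (simp add: algebra_simps)
    qed
    also have "\<tau> / (2 * c) * pairing Ma Mb (R k) (R k) \<le> \<tau> / (2 * c) * (real Ma * real Mb * B\<^sup>2)"
    proof (rule mult_left_mono)
      have "pairing Ma Mb (R k) (R k) \<le> (\<Sum>i=1..Ma - 1. \<Sum>j=1..Mb - 1. B\<^sup>2)"
        unfolding pairing_def
      proof (intro sum_mono)
        fix i j assume "i \<in> {1..Ma - 1}" "j \<in> {1..Mb - 1}"
        then have "\<bar>R k i j\<bar> \<le> B" unfolding R_def using \<open>k < N\<close> by (intro trunc) auto
        then have "\<bar>R k i j\<bar>\<^sup>2 \<le> B\<^sup>2" by (intro power_mono) auto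
        then show "R k i j * R k i j \<le> B\<^sup>2" by (simp add: power2_eq_square)
      qed
      also have "\<dots> = real (Ma - 1) * real (Mb - 1) * B\<^sup>2" by simp
      also have "\<dots> \<le> real Ma * real Mb * B\<^sup>2"
        by (intro mult_right_mono mult_mono) auto
      finally show "pairing Ma Mb (R k) (R k) \<le> real Ma * real Mb * B\<^sup>2" .
    qed (use c h in simp)
    finally show ?thesis by simp
  qed
  have E_bound: "E k \<le> real k * (\<tau> / (2 * c) * (real Ma * real Mb * B\<^sup>2))" if "k \<le> N" for k
    using that
  proof (induction k)
    case 0
    then show ?case by (simp add: E_def e_0 Gx_def Gy_def bidiag_def)
  next
    case (Suc k)
    let ?b = "\<tau> / (2 * c) * (real Ma * real Mb * B\<^sup>2)"
    have "E (Suc k) \<le> E k + ?b" using Suc.prems by (intro E_step) simp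
    moreover have "E k \<le> real k * ?b" using Suc.prems by (intro Suc.IH) simp
    ultimately show ?case unfolding of_nat_Suc distrib_right mult_1_left by linarith
  qed
  have "grid_norm ha hb Ma Mb (\<lambda>i j. v k i j - U k i j) = sqrt (ha * hb * pairing Ma Mb (e k) (e k))"
    unfolding grid_norm_def pairing_def
    using e k by (intro arg_cong[where f = sqrt] arg_cong2[where f = "(*)"] sum.cong refl)
      (auto simp: power2_eq_square)
  also have "\<dots> \<le> sqrt ((\<bar>B\<bar> / c)\<^sup>2 * (T * La * Lb))"
  proof (rule real_sqrt_le_mono)
    have "c * pairing Ma Mb (e k) (e k) \<le> E k"
      using sum_Gy_Gx_square_ge[OF \<alpha> \<beta> van] by (simp add: c_def E_def)
    also have "\<dots> \<le> real k * (\<tau> / (2 * c) * (real Ma * real Mb * B\<^sup>2))"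
      by (rule E_bound[OF k])
    also have "\<dots> \<le> real N * (\<tau> / (2 * c) * (real Ma * real Mb * B\<^sup>2))"
      using k c h by (intro mult_right_mono) auto
    also have "\<dots> \<le> real N * (\<tau> / c * (real Ma * real Mb * B\<^sup>2))"
      using c h by (intro mult_left_mono mult_right_mono divide_left_mono) auto
    finally have "ha * hb * (c * pairing Ma Mb (e k) (e k)) \<le>
        ha * hb * (real N * (\<tau> / c * (real Ma * real Mb * B\<^sup>2)))"
      using h by (intro mult_left_mono) auto
    also have "\<dots> = (real N * \<tau>) * (ha * real Ma) * (hb * real Mb) * B\<^sup>2 / c" by simp
    also have "\<dots> = T * La * Lb * B\<^sup>2 / c"
      using M by (simp add: \<tau>_def ha_def hb_def step_def)
    finally have "ha * hb * pairing Ma Mb (e k) (e k) \<le> T * La * Lb * B\<^sup>2 / c / c"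
      using c by (subst pos_le_divide_eq) (simp_all add: mult_ac)
    then show "ha * hb * pairing Ma Mb (e k) (e k) \<le> (\<bar>B\<bar> / c)\<^sup>2 * (T * La * Lb)"
      by (simp add: power_divide power2_eq_square mult_ac)
  qed
  also have "\<dots> = \<bar>B\<bar> / c * sqrt (T * La * Lb)"
    using c by (simp add: real_sqrt_mult)
  finally show ?thesis by (simp add: ha_def hb_def U_def c_def)
qed

theorem theorem5p9:
  fixes \<alpha> \<beta> K\<^sub>\<alpha> K\<^sub>\<beta> La Lb T :: real
    and f u :: "real \<Rightarrow> real \<Rightarrow> real \<Rightarrow> real"
    and u0 :: "real \<Rightarrow> real \<Rightarrow> real"
  assumes "1 < \<alpha>" "\<alpha> < 2" "1 < \<beta>" "\<beta> < 2"
    and "K\<^sub>\<alpha> > 0" "K\<^sub>\<beta> > 0" "La > 0" "Lb > 0" "T > 0"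
    and "is_pde_solution \<alpha> \<beta> K\<^sub>\<alpha> K\<^sub>\<beta> La Lb T f u0 u"
    and "\<exists>C>0. \<forall>Ma>0. \<forall>Mb>0. \<forall>N>0.
           \<forall>i\<in>{1..Ma - 1}. \<forall>j\<in>{1..Mb - 1}. \<forall>k\<in>{0..N - 1}.
             \<bar>truncation_error \<alpha> \<beta> K\<^sub>\<alpha> K\<^sub>\<beta> La Lb T f u Ma Mb N k i j\<bar>
               \<le> C * ((step T N)\<^sup>2 + step La Ma ^ 3 + step Lb Mb ^ 3)"
  shows "\<exists>C\<^sub>2>0. \<forall>Ma>0. \<forall>Mb>0. \<forall>N>0. \<forall>v.
           is_scheme_solution \<alpha> \<beta> K\<^sub>\<alpha> K\<^sub>\<beta> La Lb T f u0 Ma Mb N v \<longrightarrow>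
           (\<forall>k\<in>{0..N}.
              grid_norm (step La Ma) (step Lb Mb) Ma Mb
                (\<lambda>i j. v k i j - sample La Lb T Ma Mb N u k i j)
              \<le> 32 * C\<^sub>2 * sqrt (T * La * Lb) * exp (8 * T)
                  * ((step T N)\<^sup>2 + step La Ma ^ 3 + step Lb Mb ^ 3))"
proof -
  obtain C where C: "C > 0"
    and trunc: "\<And>Ma Mb N i j k. Ma > 0 \<Longrightarrow> Mb > 0 \<Longrightarrow> N > 0 \<Longrightarrow>
      i \<in> {1..Ma - 1} \<Longrightarrow> j \<in> {1..Mb - 1} \<Longrightarrow> k \<in> {0..N - 1} \<Longrightarrow>
      \<bar>truncation_error \<alpha> \<beta> K\<^sub>\<alpha> K\<^sub>\<beta> La Lb T f u Ma Mb N k i j\<bar>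
        \<le> C * ((step T N)\<^sup>2 + step La Ma ^ 3 + step Lb Mb ^ 3)"
    using assms(11) by metis
  define C\<^sub>2 where "C\<^sub>2 = C / ((1 - 4 * \<sigma>\<^sub>2 \<alpha>) * (1 - 4 * \<sigma>\<^sub>2 \<beta>))"
  have C\<^sub>2: "C\<^sub>2 > 0"
    using C sigma2_bounds[of \<alpha>] sigma2_bounds[of \<beta>] assms(1-4) by (simp add: C\<^sub>2_def)
  show ?thesis
  proof (intro exI[of _ C\<^sub>2] conjI C\<^sub>2 allI impI ballI)
    fix Ma Mb N v k
    assume M: "Ma > 0" "Mb > 0" "N > 0"
      and scheme: "is_scheme_solution \<alpha> \<beta> K\<^sub>\<alpha> K\<^sub>\<beta> La Lb T f u0 Ma Mb N v"
      and k: "k \<in> {0..N}"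
    define D where "D = (step T N)\<^sup>2 + step La Ma ^ 3 + step Lb Mb ^ 3"
    have D: "D \<ge> 0" using assms by (simp add: D_def step_def)
    have "grid_norm (step La Ma) (step Lb Mb) Ma Mb (\<lambda>i j. v k i j - sample La Lb T Ma Mb N u k i j)
        \<le> \<bar>C * D\<bar> / ((1 - 4 * \<sigma>\<^sub>2 \<alpha>) * (1 - 4 * \<sigma>\<^sub>2 \<beta>)) * sqrt (T * La * Lb)"
      using k unfolding D_def
      by (intro scheme_error_bound[OF assms(1-10) M scheme] trunc[OF M]) auto
    also have "\<dots> = 1 * (C\<^sub>2 * sqrt (T * La * Lb) * D)"
      using C D by (simp add: C\<^sub>2_def abs_mult)
    also have "\<dots> \<le> (32 * exp (8 * T)) * (C\<^sub>2 * sqrt (T * La * Lb) * D)"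
    proof (rule mult_right_mono)
      have "1 \<le> exp (8 * T)" using \<open>T > 0\<close> by simp
      then show "1 \<le> 32 * exp (8 * T)" by linarith
    qed (use C\<^sub>2 D assms in simp)
    finally show "grid_norm (step La Ma) (step Lb Mb) Ma Mb
          (\<lambda>i j. v k i j - sample La Lb T Ma Mb N u k i j)
        \<le> 32 * C\<^sub>2 * sqrt (T * La * Lb) * exp (8 * T)
            * ((step T N)\<^sup>2 + step La Ma ^ 3 + step Lb Mb ^ 3)"
      by (simp add: D_def mult_ac)
  qed
qed

end
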